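(* For a finite graph $G=(V,E)$ let ${\rm OPT}(G)$ be the optimal value (infimum) of the following semidefinite program over unit vectors $\{{\bf v}_i: i\in\{0\}\cup V\}\subseteq\mathbb{R}^m$ ($m$ arbitrary): $$\text{minimize } \sum_{i\in V}\frac{1+{\bf v}_0\cdot{\bf v}_i}{2}$$ subject to: $({\bf v}_i-{\bf v}_0)\cdot({\bf v}_j-{\bf v}_0)=0$ for all $ij\in E$; and for all $i,j,k\in\{0\}\cup V$: $({\bf v}_i-{\bf v}_k)\cdot({\bf v}_j-{\bf v}_k)\ge 0$, $({\bf v}_i+{\bf v}_k)\cdot({\bf v}_j-{\bf v}_k)\ge 0$, and $({\bf v}_i+{\bf v}_k)\cdot({\bf v}_j+{\bf v}_k)\ge 0$; and $\|{\bf v}_i\|=1$ for all $i\in\{0\}\cup V$. Then for every $\epsilon>0$ there is a finite graph $G$ with ${\rm vc}(G)> (2-\epsilon)\,{\rm OPT}(G)$, where ${\rm vc}(G)$ is the size of a minimum vertex cover of $G$; i.e. the integrality gap of this relaxation is bigger than $2-\epsilon$ for every $\epsilon>0$.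
   Context: These constraints express the triangle inequalities for the squared Euclidean distance on the set $\{{\bf v}_i\}\cup\{-{\bf v}_i\}$, $i\in\{0\}\cup V$, added to the standard vertex cover SDP.
   Formalization: The mixed constraint is taken as (v_i+v_k)·(v_j−v_k) ≤ 0, the actual triangle inequality on {v_i}∪{−v_i}; with the printed sign ≥ 0, taking i=k forces all vectors to be equal, so OPT(G)=|V| and the claim fails for ε ≤ 1. *)

theory Defs
  imports
    Complex_Main
    "Graph_Theory.Pair_Digraph"
    "Jordan_Normal_Form.Matrix"
begin

text \<open>Finite simple graphs are the \<^locale>\<open>pair_graph\<close>s: an undirected edge \<open>ij\<close> is
  the pair of opposite arcs \<open>(i, j)\<close>, \<open>(j, i)\<close>.\<close>

definition vertex_cover :: "'a pair_pre_digraph \<Rightarrow> 'a set \<Rightarrow> bool" where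
  "vertex_cover G C \<longleftrightarrow> C \<subseteq> pverts G \<and> (\<forall>(i, j) \<in> parcs G. i \<in> C \<or> j \<in> C)"

definition vc :: "'a pair_pre_digraph \<Rightarrow> nat" where
  "vc G = (LEAST k. \<exists>C. vertex_cover G C \<and> card C = k)"

definition eucl_norm :: "real vec \<Rightarrow> real" where
  "eucl_norm x = sqrt (x \<bullet> x)"

text \<open>The index set \<open>{0} \<union> V\<close> is rendered in \<open>'a option\<close>: \<^term>\<open>None\<close> is the extra index \<open>0\<close>
  (which is never a vertex, even if the vertices are numbers), \<open>Some i\<close> is the vertex \<open>i\<close>.\<close>

definition sdp_index :: "'a pair_pre_digraph \<Rightarrow> 'a option set" where
  "sdp_index G = insert None (Some ` pverts G)"

text \<open>The triangle inequalities for the squared Euclidean distance on \<open>{v i} \<union> {- v i}\<close>.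
  The mixed inequality says that the angle at \<open>v k\<close> between \<open>- v i\<close> and \<open>v j\<close> is not obtuse,
  \<open>(- v i - v k) \<bullet> (v j - v k) \<ge> 0\<close>, so for the product \<open>(v i + v k) \<bullet> (v j - v k)\<close> the sign
  is \<open>\<le> 0\<close>. With \<open>\<ge> 0\<close> it would not be a triangle inequality, and all \<open>v i\<close> would have to
  coincide; see \<open>triangle_constraints_iff\<close> and \<open>mixed_nonneg_collapse\<close> below.\<close>

definition triangle_constraints :: "'b set \<Rightarrow> ('b \<Rightarrow> real vec) \<Rightarrow> bool" where
  "triangle_constraints I v \<longleftrightarrow>
     (\<forall>i\<in>I. \<forall>j\<in>I. \<forall>k\<in>I.
        (v i - v k) \<bullet> (v j - v k) \<ge> 0 \<and>
        (v i + v k) \<bullet> (v j - v k) \<le> 0 \<and>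
        (v i + v k) \<bullet> (v j + v k) \<ge> 0)"

definition sdp_feasible :: "'a pair_pre_digraph \<Rightarrow> nat \<Rightarrow> ('a option \<Rightarrow> real vec) \<Rightarrow> bool" where
  "sdp_feasible G m v \<longleftrightarrow>
     (\<forall>i\<in>sdp_index G. v i \<in> carrier_vec m) \<and>
     (\<forall>i\<in>sdp_index G. eucl_norm (v i) = 1) \<and>
     (\<forall>(i, j) \<in> parcs G. (v (Some i) - v None) \<bullet> (v (Some j) - v None) = 0) \<and>
     triangle_constraints (sdp_index G) v"

definition sdp_value :: "'a pair_pre_digraph \<Rightarrow> ('a option \<Rightarrow> real vec) \<Rightarrow> real" where
  "sdp_value G v = (\<Sum>i\<in>pverts G. (1 + v None \<bullet> v (Some i)) / 2)"

text \<open>The set of objective values is nonempty and bounded below by \<open>0\<close>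
  (\<open>sdp_values_nonempty\<close>, \<open>sdp_values_bdd_below\<close>), so this is a genuine infimum.\<close>

definition OPT :: "'a pair_pre_digraph \<Rightarrow> real" where
  "OPT G = Inf {sdp_value G v | m v. sdp_feasible G m v}"


definition sqdist :: "real vec \<Rightarrow> real vec \<Rightarrow> real" where
  "sqdist x y = (eucl_norm (x - y))\<^sup>2"

lemma scalar_prod_self_nonneg: "(x :: real vec) \<bullet> x \<ge> 0"
  by (simp add: scalar_prod_def sum_nonneg)

lemma triangle_iff_inner:
  fixes x y z :: "real vec"
  assumes "x \<in> carrier_vec m" "y \<in> carrier_vec m" "z \<in> carrier_vec m"
  shows "sqdist x y \<le> sqdist x z + sqdist z y \<longleftrightarrow> (x - z) \<bullet> (y - z) \<ge> 0"
proof -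
  have "sqdist x z + sqdist z y - sqdist x y = 2 * ((x - z) \<bullet> (y - z))"
    using assms
    by (simp add: sqdist_def eucl_norm_def scalar_prod_self_nonneg)
       (auto simp: scalar_prod_def algebra_simps sum_subtractf sum.distrib sum_distrib_left)
  then show ?thesis by linarith
qed

lemma triangle_constraints_iff:
  assumes "\<And>i. i \<in> I \<Longrightarrow> v i \<in> carrier_vec m"
  shows "triangle_constraints I v \<longleftrightarrow>
    (\<forall>x \<in> v ` I \<union> (\<lambda>i. - v i) ` I. \<forall>y \<in> v ` I \<union> (\<lambda>i. - v i) ` I. \<forall>z \<in> v ` I \<union> (\<lambda>i. - v i) ` I.
       sqdist x y \<le> sqdist x z + sqdist z y)"
    (is "_ \<longleftrightarrow> ?R")
proof -
  have car: "v i \<in> carrier_vec m" "- v i \<in> carrier_vec m" if "i \<in> I" for i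
    using assms[OF that] by auto
  have e1: "(- v i - v k) \<bullet> (- v j - v k) = (v i + v k) \<bullet> (v j + v k)"
    and e2: "(- v i - v k) \<bullet> (v j - v k) = - ((v i + v k) \<bullet> (v j - v k))"
    and e3: "(v i - v k) \<bullet> (- v j - v k) = - ((v j + v k) \<bullet> (v i - v k))"
    and e4: "(v i - - v k) \<bullet> (v j - - v k) = (v i + v k) \<bullet> (v j + v k)"
    and e5: "(- v i - - v k) \<bullet> (v j - - v k) = - ((v j + v k) \<bullet> (v i - v k))"
    and e6: "(v i - - v k) \<bullet> (- v j - - v k) = - ((v i + v k) \<bullet> (v j - v k))"
    and e7: "(- v i - - v k) \<bullet> (- v j - - v k) = (v i - v k) \<bullet> (v j - v k)"
    if "i \<in> I" "j \<in> I" "k \<in> I" for i j k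
    using that[THEN assms]
    by (auto simp: scalar_prod_def sum_negf[symmetric] algebra_simps intro!: sum.cong)
  have "?R \<longleftrightarrow> (\<forall>i\<in>I. \<forall>j\<in>I. \<forall>k\<in>I.
      (v i - v k) \<bullet> (v j - v k) \<ge> 0 \<and> (v i - v k) \<bullet> (- v j - v k) \<ge> 0 \<and>
      (- v i - v k) \<bullet> (v j - v k) \<ge> 0 \<and> (- v i - v k) \<bullet> (- v j - v k) \<ge> 0 \<and>
      (v i - - v k) \<bullet> (v j - - v k) \<ge> 0 \<and> (v i - - v k) \<bullet> (- v j - - v k) \<ge> 0 \<and>
      (- v i - - v k) \<bullet> (v j - - v k) \<ge> 0 \<and> (- v i - - v k) \<bullet> (- v j - - v k) \<ge> 0)"
    by (simp add: ball_Un ball_conj_distrib triangle_iff_inner[OF car(1) car(1) car(1)]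
        triangle_iff_inner[OF car(1) car(1) car(2)] triangle_iff_inner[OF car(1) car(2) car(1)]
        triangle_iff_inner[OF car(1) car(2) car(2)] triangle_iff_inner[OF car(2) car(1) car(1)]
        triangle_iff_inner[OF car(2) car(1) car(2)] triangle_iff_inner[OF car(2) car(2) car(1)]
        triangle_iff_inner[OF car(2) car(2) car(2)] cong: ball_cong)
       (rule iffI; elim conjE; intro conjI; assumption)
  also have "\<dots> \<longleftrightarrow> triangle_constraints I v"
    unfolding triangle_constraints_def
    by (simp add: e1 e2 e3 e4 e5 e6 e7 ball_conj_distrib cong: ball_cong) (rule iffI; elim conjE; intro conjI; blast)
  finally show ?thesis by blast
qed

lemma mixed_nonneg_collapse:
  assumes "\<And>i. i \<in> I \<Longrightarrow> v i \<in> carrier_vec m" "\<And>i. i \<in> I \<Longrightarrow> eucl_norm (v i) = 1"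
    and mixed: "\<And>i j k. i \<in> I \<Longrightarrow> j \<in> I \<Longrightarrow> k \<in> I \<Longrightarrow> (v i + v k) \<bullet> (v j - v k) \<ge> 0"
    and ij: "i \<in> I" "j \<in> I"
  shows "v i = v j"
proof -
  have c: "v i \<in> carrier_vec m" "v j \<in> carrier_vec m" and n: "v i \<bullet> v i = 1" "v j \<bullet> v j = 1"
    using assms(1,2) ij by (auto simp: eucl_norm_def)
  have "(v j + v j) \<bullet> (v i - v j) = 2 * (v i \<bullet> v j) - 2 * (v j \<bullet> v j)"
    using c by (auto simp: scalar_prod_def algebra_simps sum_subtractf sum.distrib sum_distrib_left)
  with mixed[of j i j] ij n have "v i \<bullet> v j \<ge> 1" by simp
  moreover have "(v i - v j) \<bullet> (v i - v j) = v i \<bullet> v i - 2 * (v i \<bullet> v j) + v j \<bullet> v j"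
    using c by (auto simp: scalar_prod_def algebra_simps sum_subtractf sum.distrib sum_distrib_left)
  ultimately have "(v i - v j) \<bullet> (v i - v j) = 0"
    using n scalar_prod_self_nonneg[of "v i - v j"] by linarith
  then have "\<forall>l<m. v i $ l = v j $ l"
    using c by (auto simp: scalar_prod_def sum_nonneg_eq_0_iff)
  then show ?thesis using c by auto
qed

lemma sdp_values_nonempty: "{sdp_value G v | m v. sdp_feasible G m v} \<noteq> {}"
proof -
  have "sdp_feasible G 1 (\<lambda>_. vec 1 (\<lambda>_. 1))"
    by (auto simp: sdp_feasible_def triangle_constraints_def eucl_norm_def scalar_prod_def)
  then show ?thesis by blast
qed

lemma sdp_values_bdd_below: "bdd_below {sdp_value G v | m v. sdp_feasible G m v}"
proof (rule bdd_belowI)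
  fix t assume "t \<in> {sdp_value G v | m v. sdp_feasible G m v}"
  then obtain m v where t: "t = sdp_value G v" and f: "sdp_feasible G m v" by blast
  have "1 + v None \<bullet> v (Some i) \<ge> 0" if "i \<in> pverts G" for i
  proof -
    have c: "v None \<in> carrier_vec m" "v (Some i) \<in> carrier_vec m"
      and n: "v None \<bullet> v None = 1" "v (Some i) \<bullet> v (Some i) = 1"
      using f that by (auto simp: sdp_feasible_def sdp_index_def eucl_norm_def)
    have "(v None + v (Some i)) \<bullet> (v None + v (Some i)) =
        v None \<bullet> v None + 2 * (v None \<bullet> v (Some i)) + v (Some i) \<bullet> v (Some i)"
      using c by (auto simp: scalar_prod_def algebra_simps sum.distrib sum_distrib_left)
    then show ?thesis
      using n scalar_prod_self_nonneg[of "v None + v (Some i)"] by linarith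
  qed
  then show "0 \<le> t" by (simp add: t sdp_value_def sum_nonneg)
qed

end

theory Submission
  imports Defs "HOL-Library.FuncSet" "HOL-Library.Nat_Bijection"
begin

text \<open>The vertices are words consisting of \<open>N\<close> bits and of a few letters over a large alphabet, and two
  words are adjacent when they agree in exactly \<open>K\<close> features, where \<open>K\<close> is tiny compared with \<open>N\<close>. A set of
  positive density contains an edge: by concentration of measure there are dense fibres over two nearly
  antipodal bit vectors, and in the letters every small number of agreements occurs between any two
  dense sets. So only vertex covers of density close to \<open>1\<close> exist. For the upper bound on the optimum,
  the normalised inner product \<open>t\<close> of two words is a cut kernel, and it is close to \<open>- 1\<close> on the edges.
  Apply the polynomial \<open>(1 - \<beta>) t + \<beta> t ^ r\<close> with \<open>r\<close> even, which preserves the triangle inequalities,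
  and add a small multiple of \<open>v\<^sub>0\<close>: the value of every vertex is then close to \<open>1 / 2\<close>.\<close>

section \<open>Nearly antipodal pairs in dense subsets of the cube\<close>

lemma sum_Pow_Suc:
  fixes f :: "nat set \<Rightarrow> 'b::comm_monoid_add"
  shows "(\<Sum>S\<in>Pow {..<Suc n}. f S) = (\<Sum>S\<in>Pow {..<n}. f S) + (\<Sum>S\<in>Pow {..<n}. f (insert n S))"
proof -
  have "inj_on (insert n) (Pow {..<n})"
    by (rule inj_on_inverseI[of _ "\<lambda>S. S - {n}"]) auto
  moreover have "Pow {..<n} \<inter> insert n ` Pow {..<n} = {}" by auto
  ultimately show ?thesis
    by (simp add: lessThan_Suc Pow_insert sum.union_disjoint sum.reindex)
qed

text \<open>Divided by \<open>4 ^ n\<close>, this bounds a variance by \<open>n / 4\<close>.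
  Induction on the dimension: the variance is the mean of the variances on two opposite facets plus
  a quarter of the squared difference of the facet means, and that difference is at most 1.\<close>

lemma variance_Lipschitz_cube:
  fixes f :: "nat set \<Rightarrow> real"
  assumes "\<And>i S. i < n \<Longrightarrow> S \<subseteq> {..<n} \<Longrightarrow> i \<notin> S \<Longrightarrow> \<bar>f (insert i S) - f S\<bar> \<le> 1"
  shows "2 ^ n * (\<Sum>S\<in>Pow {..<n}. (f S)\<^sup>2) - (\<Sum>S\<in>Pow {..<n}. f S)\<^sup>2 \<le> n / 4 * 4 ^ n"
  using assms
proof (induction n arbitrary: f)
  case 0
  then show ?case by simp
next
  case (Suc n)
  define a b F G where "a = (\<Sum>S\<in>Pow {..<n}. f S)" and "b = (\<Sum>S\<in>Pow {..<n}. f (insert n S))"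
    and "F = (\<Sum>S\<in>Pow {..<n}. (f S)\<^sup>2)" and "G = (\<Sum>S\<in>Pow {..<n}. (f (insert n S))\<^sup>2)"
  have sub: "S \<subseteq> {..<n} \<Longrightarrow> S \<subseteq> {..<Suc n}" for S by auto
  have 1: "2 ^ n * F - a\<^sup>2 \<le> n / 4 * 4 ^ n"
    unfolding F_def a_def by (rule Suc.IH) (use Suc.prems sub in auto)
  have 2: "2 ^ n * G - b\<^sup>2 \<le> n / 4 * 4 ^ n"
    unfolding G_def b_def
  proof (rule Suc.IH)
    fix i S assume "i < n" "S \<subseteq> {..<n}" "i \<notin> S"
    then show "\<bar>f (insert n (insert i S)) - f (insert n S)\<bar> \<le> 1"
      using Suc.prems[of i "insert n S"] sub[of S] by (auto simp: insert_commute)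
  qed
  have "\<bar>b - a\<bar> \<le> (\<Sum>S\<in>Pow {..<n}. \<bar>f (insert n S) - f S\<bar>)"
    unfolding a_def b_def sum_subtractf[symmetric] by (rule sum_abs)
  also have "\<dots> \<le> (\<Sum>S\<in>Pow {..<n}. 1)"
    by (rule sum_mono) (use Suc.prems sub in auto)
  also have "\<dots> = 2 ^ n" by (simp add: card_Pow)
  finally have "\<bar>b - a\<bar>\<^sup>2 \<le> (2 ^ n)\<^sup>2" by (intro power_mono) auto
  moreover have "(2 ^ n)\<^sup>2 = (4::real) ^ n"
    by (simp add: power2_eq_square power_mult_distrib[symmetric])
  ultimately have 3: "(b - a)\<^sup>2 \<le> 4 ^ n" by simp
  have "2 ^ Suc n * (F + G) - (a + b)\<^sup>2 = 2 * (2 ^ n * F - a\<^sup>2) + 2 * (2 ^ n * G - b\<^sup>2) + (b - a)\<^sup>2"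
    by (simp add: power2_eq_square algebra_simps)
  also have "\<dots> \<le> 2 * (n / 4 * 4 ^ n) + 2 * (n / 4 * 4 ^ n) + 4 ^ n"
    using 1 2 3 by (intro add_mono mult_left_mono) auto
  also have "\<dots> = Suc n / 4 * 4 ^ Suc n" by (simp add: field_simps)
  finally show ?case
    by (simp add: sum_Pow_Suc F_def G_def a_def b_def)
qed

definition hamming :: "nat set \<Rightarrow> nat set \<Rightarrow> nat" where
  "hamming S T = card (S - T \<union> (T - S))"

lemma hamming_self [simp]: "hamming S S = 0"
  by (simp add: hamming_def)

lemma hamming_flip_le:
  assumes "finite S" "finite T"
  shows "hamming (insert i S) T \<le> Suc (hamming S T)" "hamming S T \<le> Suc (hamming (insert i S) T)"
proof -
  have "hamming (insert i S) T \<le> card (insert i (S - T \<union> (T - S)))"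
    unfolding hamming_def using assms by (intro card_mono) auto
  then show "hamming (insert i S) T \<le> Suc (hamming S T)"
    using assms by (simp add: hamming_def card_insert_if split: if_splits)
  have "hamming S T \<le> card (insert i (insert i S - T \<union> (T - insert i S)))"
    unfolding hamming_def using assms by (intro card_mono) auto
  then show "hamming S T \<le> Suc (hamming (insert i S) T)"
    using assms by (simp add: hamming_def card_insert_if split: if_splits)
qed

lemma hamming_complement:
  assumes "S \<subseteq> {..<n}" "T \<subseteq> {..<n}"
  shows "hamming ({..<n} - S) T = card {i\<in>{..<n}. i \<in> S \<longleftrightarrow> i \<in> T}"
  unfolding hamming_def by (rule arg_cong[of _ _ card]) (use assms in auto)

text \<open>Chebyshev's inequality for the distance to \<open>A\<close>, applied on \<open>A\<close> and on the set of
  complements of \<open>A\<close>.\<close>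

lemma nearly_antipodal_pair:
  fixes A :: "nat set set"
  assumes A: "A \<subseteq> Pow {..<n}" and dens: "2 ^ n \<le> L * card A" and n: "L * n \<le> k\<^sup>2"
  shows "\<exists>S\<in>A. \<exists>T\<in>A. card {i\<in>{..<n}. i \<in> S \<longleftrightarrow> i \<in> T} \<le> k"
proof (rule ccontr)
  assume "\<not> ?thesis"
  then have far: "k < hamming ({..<n} - S) T" if "S \<in> A" "T \<in> A" for S T
    using that A hamming_complement[of S n T] by force
  have fA: "finite A" using A finite_subset by auto
  have ne: "A \<noteq> {}" using dens by auto
  have fin: "finite S" if "S \<subseteq> {..<n}" for S using that finite_subset by auto
  \<comment> \<open>The distance to \<open>A\<close>: a minimum of 1-Lipschitz functions, hence
    1-Lipschitz.\<close>
  define d where "d S = Min (hamming S ` A)" for S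
  have d_le: "d S \<le> hamming S T" if "T \<in> A" for S T
    unfolding d_def using fA that by auto
  have d_ex: "\<exists>T\<in>A. d S = hamming S T" for S
  proof -
    have "d S \<in> hamming S ` A" unfolding d_def using fA ne by (intro Min_in) auto
    then show ?thesis by auto
  qed
  have lip: "\<bar>real (d (insert i S)) - real (d S)\<bar> \<le> 1" if "S \<subseteq> {..<n}" for i S
  proof -
    obtain T T' where T: "T \<in> A" "d S = hamming S T" "T' \<in> A" "d (insert i S) = hamming (insert i S) T'"
      using d_ex by meson
    have "finite S" "finite T" "finite T'" using fin that T A by blast+
    then have "d (insert i S) \<le> Suc (d S)" "d S \<le> Suc (d (insert i S))"
      using T d_le[of T "insert i S"] d_le[of T' S] hamming_flip_le[of S T i] hamming_flip_le[of S T' i]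
      by linarith+
    then show ?thesis by linarith
  qed
  have dens': "2 ^ n \<le> real L * real (card A)"
    using of_nat_mono[OF dens, where 'a = real] by simp
  define m where "m = (\<Sum>S\<in>Pow {..<n}. real (d S)) / 2 ^ n"
  have "(\<Sum>S\<in>Pow {..<n}. (real (d S) - m)\<^sup>2)
      = (\<Sum>S\<in>Pow {..<n}. (real (d S))\<^sup>2) - 2 * m * (\<Sum>S\<in>Pow {..<n}. real (d S)) + 2 ^ n * m\<^sup>2"
    by (simp add: power2_diff sum.distrib sum_subtractf card_Pow sum_distrib_left mult_ac)
  then have "2 ^ n * (\<Sum>S\<in>Pow {..<n}. (real (d S) - m)\<^sup>2)
      = 2 ^ n * (\<Sum>S\<in>Pow {..<n}. (real (d S))\<^sup>2) - (\<Sum>S\<in>Pow {..<n}. real (d S))\<^sup>2"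
    by (simp add: m_def field_simps power2_eq_square)
  also have "\<dots> \<le> n / 4 * 4 ^ n"
    by (rule variance_Lipschitz_cube) (use lip in auto)
  also have "(4::real) ^ n = 2 ^ n * 2 ^ n" by (simp add: power_mult_distrib[symmetric])
  finally have var: "(\<Sum>S\<in>Pow {..<n}. (real (d S) - m)\<^sup>2) \<le> n / 4 * 2 ^ n"
    by (simp add: field_simps)
  \<comment> \<open>As \<open>B\<close> has density at least \<open>1 / L\<close>, a deviation
    \<open>c\<close> on all of \<open>B\<close> forces a variance of at least
    \<open>c\<^sup>2 / L\<close>; then \<open>L * n \<le> k\<^sup>2\<close> is used.\<close>
  have cheb: "c\<^sup>2 \<le> k\<^sup>2 / 4"
    if B: "B \<subseteq> Pow {..<n}" "card B = card A" "\<And>S. S \<in> B \<Longrightarrow> c\<^sup>2 \<le> (real (d S) - m)\<^sup>2" for B and c :: real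
  proof -
    have "card A * c\<^sup>2 = (\<Sum>S\<in>B. c\<^sup>2)" using B by simp
    also have "\<dots> \<le> (\<Sum>S\<in>B. (real (d S) - m)\<^sup>2)" by (rule sum_mono) (use B in auto)
    also have "\<dots> \<le> (\<Sum>S\<in>Pow {..<n}. (real (d S) - m)\<^sup>2)" by (rule sum_mono2) (use B in auto)
    also note var
    finally have "card A * c\<^sup>2 \<le> n / 4 * 2 ^ n" .
    also have "\<dots> \<le> n / 4 * (L * card A)"
      using dens' by (intro mult_left_mono) auto
    finally have "card A * c\<^sup>2 \<le> card A * (real (L * n) / 4)" by (simp add: mult_ac)
    moreover have "card A > 0" using fA ne by (simp add: card_gt_0_iff)
    ultimately have "c\<^sup>2 \<le> real (L * n) / 4" by (simp add: mult_le_cancel_left_pos del: of_nat_mult)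
    also have "\<dots> \<le> real (k\<^sup>2) / 4" using n by (simp only: of_nat_le_iff divide_right_mono)
    finally show ?thesis by simp
  qed
  have "m\<^sup>2 \<le> (k / 2)\<^sup>2"
  proof -
    have "d S = 0" if "S \<in> A" for S using d_le[OF that, of S] by simp
    then show ?thesis using cheb[of A m] A by (simp add: power_divide)
  qed
  then have m: "m \<le> k / 2" by (rule power2_le_imp_le) simp
  let ?B = "(\<lambda>S. {..<n} - S) ` A"
  have "inj_on (\<lambda>S. {..<n} - S) A"
  proof (rule inj_onI)
    fix S T assume "S \<in> A" "T \<in> A" "{..<n} - S = {..<n} - T"
    then show "S = T" using A by (metis PowD double_diff subset_iff order_refl)
  qed
  then have "card ?B = card A" by (rule card_image)
  \<comment> \<open>By \<open>far\<close>, \<open>d\<close> exceeds \<open>k\<close> on the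
    complements while its mean is at most \<open>k / 2\<close>, a larger deviation than
    \<open>cheb\<close> allows.\<close>
  moreover have "(k + 1 - m)\<^sup>2 \<le> (real (d S) - m)\<^sup>2" if "S \<in> ?B" for S
  proof -
    have "real k + 1 \<le> d S" using that d_ex[of S] far by force
    then show ?thesis using m by (intro power_mono) auto
  qed
  ultimately have "(k + 1 - m)\<^sup>2 \<le> (k / 2)\<^sup>2"
    using cheb[of ?B "k + 1 - m"] by (auto simp: power_divide)
  then have "k + 1 - m \<le> k / 2" by (rule power2_le_imp_le) simp
  with m show False by simp
qed

section \<open>Exact agreement between dense sets of words\<close>

text \<open>\<open>X\<close> lies in the product of its projections, enlarged to full
  \<open>\<phi>\<close>-classes, and every coordinate in \<open>B\<close> saves a factor 2. Read
  backwards: in all but a few blocks a dense set reaches the classes of more than half of the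
  letters.\<close>

lemma card_le_prod_projections:
  fixes U :: "'u set"
  assumes "finite U" "X \<subseteq> {..<R} \<rightarrow>\<^sub>E U" and B: "B \<subseteq> {..<R}"
    and half: "\<And>b. b \<in> B \<Longrightarrow> 2 * card {u\<in>U. \<exists>x\<in>X. \<phi> (x b) = \<phi> u} \<le> card U"
  shows "2 ^ card B * card X \<le> card U ^ R"
proof -
  define T where "T b = {u\<in>U. \<exists>x\<in>X. \<phi> (x b) = \<phi> u}" for b
  have T: "finite (T b)" "card (T b) \<le> card U" for b
    using assms(1) by (auto simp: T_def intro: card_mono)
  have fB: "finite B" using B finite_subset by blast
  have "X \<subseteq> Pi\<^sub>E {..<R} T"
    using assms(2) by (fastforce simp: T_def PiE_iff)
  then have "card X \<le> card (Pi\<^sub>E {..<R} T)"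
    by (intro card_mono finite_PiE) (auto simp: T)
  also have "\<dots> = (\<Prod>b<R. card (T b))" by (simp add: card_PiE)
  also have "\<dots> = (\<Prod>b\<in>B. card (T b)) * (\<Prod>b\<in>{..<R} - B. card (T b))"
    using B by (simp add: prod.subset_diff mult.commute)
  finally have "2 ^ card B * card X \<le> (\<Prod>b\<in>B. 2 * card (T b)) * (\<Prod>b\<in>{..<R} - B. card (T b))"
    by (simp add: prod.distrib mult_ac)
  also have "\<dots> \<le> (\<Prod>b\<in>B. card U) * (\<Prod>b\<in>{..<R} - B. card U)"
    using half T by (intro mult_mono prod_mono) (auto simp: T_def)
  also have "\<dots> = card U ^ (card B + card ({..<R} - B))"
    by (simp add: power_add)
  also have "card B + card ({..<R} - B) = R"
    using B fB card_mono[OF _ B] by (simp add: card_Diff_subset)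
  finally show ?thesis .
qed

lemma card_PiE_shrink_factor:
  assumes "finite I" "c \<in> I" "q * card Y \<le> card (F c)"
  shows "q * card (Pi\<^sub>E I (F(c := Y))) \<le> card (Pi\<^sub>E I F)"
proof -
  have "(\<Prod>i\<in>I - {c}. card ((F(c := Y)) i)) = (\<Prod>i\<in>I - {c}. card (F i))"
    by (rule prod.cong) auto
  then have "q * card (Pi\<^sub>E I (F(c := Y))) = q * card Y * (\<Prod>i\<in>I - {c}. card (F i))"
    using assms(1,2) by (simp add: card_PiE prod.remove)
  also have "\<dots> \<le> card (F c) * (\<Prod>i\<in>I - {c}. card (F i))"
    using assms(3) by (rule mult_right_mono) simp
  finally show ?thesis using assms(1,2) by (simp add: card_PiE prod.remove)
qed

text \<open>A \<open>q\<close>-adic system of prefixes: \<open>\<pi> a u\<close> is the prefix of length \<open>a\<close> of the letter \<open>u\<close>.\<close>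

locale prefix_system =
  fixes U :: "'u set" and \<pi> :: "nat \<Rightarrow> 'u \<Rightarrow> nat" and q K :: nat
  assumes finite_U: "finite U" and U_nonempty: "U \<noteq> {}"
    and prefix_0: "u \<in> U \<Longrightarrow> \<pi> 0 u = 0"
    and nested: "u \<in> U \<Longrightarrow> u' \<in> U \<Longrightarrow> a < K \<Longrightarrow> \<pi> (Suc a) u = \<pi> (Suc a) u' \<Longrightarrow> \<pi> a u = \<pi> a u'"
    and branching: "u \<in> U \<Longrightarrow> a < K \<Longrightarrow>
      q * card {u'\<in>U. \<pi> (Suc a) u' = \<pi> (Suc a) u} \<le> card {u'\<in>U. \<pi> a u' = \<pi> a u}"
begin

text \<open>By \<open>nested\<close>, the length of the longest common prefix, at most
  \<open>K\<close>.\<close>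

definition agree :: "'u \<Rightarrow> 'u \<Rightarrow> nat" where
  "agree u u' = card {i\<in>{1..K}. \<pi> i u = \<pi> i u'}"

lemma prefix_antimono:
  assumes "u \<in> U" "u' \<in> U" "\<pi> j u = \<pi> j u'" "i \<le> j" "j \<le> K"
  shows "\<pi> i u = \<pi> i u'"
  using assms(4,3,5)
proof (induction rule: dec_induct)
  case (step m)
  then show ?case using nested[OF assms(1,2), of m] by auto
qed auto

lemma agree_eqI:
  assumes "u \<in> U" "u' \<in> U" "a \<le> K" "\<pi> a u = \<pi> a u'" "a < K \<Longrightarrow> \<pi> (Suc a) u \<noteq> \<pi> (Suc a) u'"
  shows "agree u u' = a"
proof -
  have "{i\<in>{1..K}. \<pi> i u = \<pi> i u'} = {1..a}"
  proof (intro Set.set_eqI iffI)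
    fix i assume i: "i \<in> {i\<in>{1..K}. \<pi> i u = \<pi> i u'}"
    have "i \<le> a"
    proof (rule ccontr)
      assume "\<not> i \<le> a"
      then have "\<pi> (Suc a) u = \<pi> (Suc a) u'"
        using i prefix_antimono[OF assms(1,2), of i "Suc a"] by auto
      then show False using assms(5) \<open>\<not> i \<le> a\<close> i by auto
    qed
    then show "i \<in> {1..a}" using i by auto
  next
    fix i assume "i \<in> {1..a}"
    then show "i \<in> {i\<in>{1..K}. \<pi> i u = \<pi> i u'}"
      using prefix_antimono[OF assms(1,2,4)] assms(3) by auto
  qed
  then show ?thesis by (simp add: agree_def)
qed

context
  fixes R :: nat
begin

abbreviation "words \<equiv> {..<R} \<rightarrow>\<^sub>E U"

definition cyl :: "nat \<Rightarrow> nat \<Rightarrow> nat \<Rightarrow> (nat \<Rightarrow> 'u) set" where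
  "cyl a b v = {w\<in>words. \<pi> a (w b) = v}"

lemma finite_words: "finite words"
  by (simp add: finite_PiE finite_U)

lemma finite_cyl: "finite (cyl a b v)"
  using finite_words by (simp add: cyl_def)

lemma cyl_eq_PiE:
  assumes "b < R"
  shows "cyl a b v = Pi\<^sub>E {..<R} ((\<lambda>_. U)(b := {u\<in>U. \<pi> a u = v}))"
proof (intro Set.set_eqI iffI)
  fix w assume "w \<in> cyl a b v"
  then show "w \<in> Pi\<^sub>E {..<R} ((\<lambda>_. U)(b := {u\<in>U. \<pi> a u = v}))"
    using assms by (simp add: cyl_def PiE_iff)
next
  fix w assume "w \<in> Pi\<^sub>E {..<R} ((\<lambda>_. U)(b := {u\<in>U. \<pi> a u = v}))"
  then have ext: "w \<in> extensional {..<R}"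
    and w: "\<And>c. c < R \<Longrightarrow> w c \<in> ((\<lambda>_. U)(b := {u\<in>U. \<pi> a u = v})) c"
    by (auto simp only: PiE_iff lessThan_iff)
  have "w c \<in> U" if "c < R" for c using w[OF that] by (auto split: if_splits)
  with ext w[OF assms] show "w \<in> cyl a b v" by (simp add: cyl_def PiE_iff)
qed

text \<open>In block \<open>b\<close> all words of the cylinder share \<open>a\<close> prefixes with
  \<open>p\<close>. The total is \<open>a\<close> unless the next prefix in block \<open>b\<close>
  or the first one in another block agrees too. Each of these \<open>R\<close> events has density at
  most \<open>1 / q\<close> in the cylinder, while \<open>Y\<close> has density above
  \<open>R / q\<close>.\<close>

lemma exact_agreement_in_cyl:
  assumes p: "p \<in> words" and b: "b < R" and a: "a \<le> K"
    and Y: "Y \<subseteq> cyl a b (\<pi> a (p b))" and heavy: "R * card (cyl a b (\<pi> a (p b))) < q * card Y"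
  shows "\<exists>w\<in>Y. (\<Sum>c<R. agree (p c) (w c)) = a"
proof -
  let ?C = "cyl a b (\<pi> a (p b))"
  define e where "e c = (if c = b then a else 0)" for c
  \<comment> \<open>More than \<open>e c\<close> agreements in block \<open>c\<close>. For
    \<open>e c = K\<close> there is no further prefix and the set is empty.\<close>
  define bad where "bad c = {w\<in>?C. e c < K \<and> \<pi> (Suc (e c)) (w c) = \<pi> (Suc (e c)) (p c)}" for c
  have pU: "p c \<in> U" if "c < R" for c using p that by auto
  have bad: "q * card (bad c) \<le> card ?C" if c: "c < R" for c
  proof (cases "e c < K")
    case True
    define F where "F = ((\<lambda>_. U)(b := {u\<in>U. \<pi> a u = \<pi> a (p b)}))"
    let ?Y = "{u\<in>U. \<pi> (Suc (e c)) u = \<pi> (Suc (e c)) (p c)}"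
    have "{u\<in>U. \<pi> (e c) u = \<pi> (e c) (p c)} \<subseteq> F c"
      by (auto simp: e_def F_def)
    moreover have "finite (F c)" using finite_U by (simp add: F_def)
    ultimately have "q * card ?Y \<le> card (F c)"
      using branching[OF pU[OF c] True] by (meson card_mono order_trans)
    then have shrink: "q * card (Pi\<^sub>E {..<R} (F(c := ?Y))) \<le> card (Pi\<^sub>E {..<R} F)"
      using c by (intro card_PiE_shrink_factor) auto
    have "bad c \<subseteq> Pi\<^sub>E {..<R} (F(c := ?Y))"
      using b c by (auto simp: bad_def F_def e_def cyl_eq_PiE PiE_iff extensional_def split: if_splits)
    then have "card (bad c) \<le> card (Pi\<^sub>E {..<R} (F(c := ?Y)))"
      by (intro card_mono finite_PiE) (auto simp: F_def finite_U)
    then have "q * card (bad c) \<le> q * card (Pi\<^sub>E {..<R} (F(c := ?Y)))" by simp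
    also note shrink
    also have "Pi\<^sub>E {..<R} F = ?C" unfolding F_def by (rule cyl_eq_PiE[OF b, symmetric])
    finally show ?thesis .
  qed (simp add: bad_def)
  have fin: "finite (\<Union>c<R. bad c)"
    by (rule finite_subset[of _ ?C]) (auto simp: bad_def finite_cyl)
  have "q * card (\<Union>c<R. bad c) \<le> (\<Sum>c<R. q * card (bad c))"
    using card_UN_le[of "{..<R}" bad] by (simp add: sum_distrib_left[symmetric])
  also have "\<dots> \<le> (\<Sum>c<R. card ?C)" by (rule sum_mono) (use bad in auto)
  also have "\<dots> < q * card Y" using heavy by simp
  finally have "card (\<Union>c<R. bad c) < card Y" by simp
  then have "\<not> Y \<subseteq> (\<Union>c<R. bad c)" using fin card_mono leD by blast
  then obtain w where w: "w \<in> Y" "w \<notin> (\<Union>c<R. bad c)" by auto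
  have wC: "w \<in> ?C" using w Y by auto
  then have wU: "w c \<in> U" if "c < R" for c using that by (auto simp: cyl_def)
  have "agree (p c) (w c) = e c" if c: "c < R" for c
  proof (rule agree_eqI[OF pU[OF c] wU[OF c]])
    show "e c \<le> K" using a by (simp add: e_def)
    show "\<pi> (e c) (p c) = \<pi> (e c) (w c)"
      using wC pU[OF c] wU[OF c] prefix_0 by (auto simp: e_def cyl_def)
    show "\<pi> (Suc (e c)) (p c) \<noteq> \<pi> (Suc (e c)) (w c)" if "e c < K"
      using w c that wC by (auto simp: bad_def)
  qed
  then have "(\<Sum>c<R. agree (p c) (w c)) = (\<Sum>c<R. e c)" by simp
  also have "\<dots> = a" using b by (simp add: e_def)
  finally show ?thesis using w(1) by blast
qed

text \<open>Words with a letter whose prefix cylinder is sparse in \<open>Q\<close> are discarded. What remains of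
  \<open>Q\<close>, as well as \<open>P\<close>, is too large to have small projections to half of the blocks.\<close>

lemma exact_agreement:
  assumes P: "P \<subseteq> words" and Q: "Q \<subseteq> words" and a: "a \<le> K"
    and dP: "card words \<le> L * card P" and dQ: "card words \<le> L * card Q"
    and L: "2 * L < 2 ^ R'" and R: "2 * R' \<le> R" and q: "2 * L * R\<^sup>2 \<le> q"
  shows "\<exists>p\<in>P. \<exists>w\<in>Q. (\<Sum>c<R. agree (p c) (w c)) = a"
proof -
  define Y where "Y b v = Q \<inter> cyl a b v" for b v
  \<comment> \<open>Prefixes whose cylinder is too sparse in \<open>Q\<close> for
    \<open>exact_agreement_in_cyl\<close>.\<close>
  define light where "light b = {v \<in> \<pi> a ` U. q * card (Y b v) \<le> R * card (cyl a b v)}" for b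
  define D where "D = (\<Union>b<R. \<Union>v\<in>light b. Y b v)"
  have fQ: "finite Q" using Q finite_words finite_subset by blast
  have fl: "finite (light b)" for b using finite_U by (simp add: light_def)
  have W0: "card words > 0"
    using finite_U U_nonempty by (simp add: card_PiE card_gt_0_iff)
  have block: "(\<Sum>v\<in>light b. q * card (Y b v)) \<le> R * card words" if "b < R" for b
  proof -
    have "(\<Sum>v\<in>light b. q * card (Y b v)) \<le> (\<Sum>v\<in>light b. R * card (cyl a b v))"
      by (rule sum_mono) (simp add: light_def)
    also have "\<dots> = R * card (\<Union>v\<in>light b. cyl a b v)"
      using fl finite_cyl by (subst card_UN_disjoint) (auto simp: cyl_def sum_distrib_left)
    also have "\<dots> \<le> R * card words"
      by (intro mult_left_mono card_mono finite_words) (auto simp: cyl_def)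
    finally show ?thesis .
  qed
  \<comment> \<open>For fixed \<open>b\<close> the cylinders are disjoint, so each block discards at
    most the fraction \<open>R / q\<close> of all words, and \<open>D\<close> has density at most
    \<open>R\<^sup>2 / q \<le> 1 / (2 * L)\<close>. Half of the density guaranteed for
    \<open>Q\<close> survives.\<close>
  have "card D \<le> (\<Sum>b<R. \<Sum>v\<in>light b. card (Y b v))"
    unfolding D_def by (intro card_UN_le[THEN order_trans] sum_mono) (auto simp: fl)
  then have "q * card D \<le> (\<Sum>b<R. \<Sum>v\<in>light b. q * card (Y b v))"
    by (simp add: sum_distrib_left[symmetric])
  also have "\<dots> \<le> (\<Sum>b<R. R * card words)"
    using block by (intro sum_mono) auto
  finally have "q * card D \<le> R\<^sup>2 * card words"
    by (simp add: power2_eq_square)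
  moreover have "2 * L * R\<^sup>2 * card D \<le> q * card D" using q by (rule mult_right_mono) simp
  moreover have "R\<^sup>2 * (2 * L * card D) = 2 * L * R\<^sup>2 * card D" by simp
  ultimately have "R\<^sup>2 * (2 * L * card D) \<le> R\<^sup>2 * card words" by linarith
  moreover have "R > 0"
  proof -
    have "L > 0" using dP W0 by (cases L) auto
    then have "R' > 0" using L by (cases R') auto
    then show ?thesis using R by simp
  qed
  ultimately have "2 * L * card D \<le> card words" by simp
  moreover have "card Q = card (Q - D) + card D"
  proof -
    have "D \<subseteq> Q" by (auto simp: D_def Y_def)
    then show ?thesis using fQ card_mono[of Q D] by (simp add: card_Diff_subset finite_subset)
  qed
  ultimately have "card words \<le> 2 * L * card (Q - D)"
    using dQ by (simp add: algebra_simps)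
  moreover have "card words \<le> 2 * L * card P" using dP by simp
  ultimately have big: "card words < 2 ^ R' * card X" if "X = P \<or> X = Q - D" for X
  proof -
    have le: "card words \<le> 2 * L * card X"
      using that \<open>card words \<le> 2 * L * card (Q - D)\<close> \<open>card words \<le> 2 * L * card P\<close> by blast
    then have "card X > 0" using W0 by (cases "card X") auto
    then have "2 * L * card X < 2 ^ R' * card X" using L by simp
    with le show ?thesis by (rule le_less_trans)
  qed
  \<comment> \<open>Blocks in which \<open>X\<close> reaches at most half of the letters, up to
    prefixes of length \<open>a\<close>. Each of the two sets has fewer than \<open>R'\<close> of
    them, so \<open>2 * R' \<le> R\<close> leaves a block where both reach more than half, and there
    they share a prefix.\<close>
  define B where "B X = {b\<in>{..<R}. 2 * card {u\<in>U. \<exists>x\<in>X. \<pi> a (x b) = \<pi> a u} \<le> card U}" for X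
  have small: "card (B X) < R'" if "X = P \<or> X = Q - D" for X
  proof (rule ccontr)
    assume "\<not> ?thesis"
    then have "2 ^ R' * card X \<le> 2 ^ card (B X) * card X"
      by (intro mult_right_mono power_increasing) auto
    also have "\<dots> \<le> card U ^ R"
      using that P Q by (intro card_le_prod_projections[OF finite_U, where \<phi> = "\<pi> a"]) (auto simp: B_def)
    also have "\<dots> = card words" by (simp add: card_PiE)
    finally show False using big[OF that] by simp
  qed
  have "card (B P \<union> B (Q - D)) < R"
    using card_Un_le[of "B P" "B (Q - D)"] small[of P] small[of "Q - D"] R by simp
  then have "\<not> {..<R} \<subseteq> B P \<union> B (Q - D)"
    using card_mono[of "B P \<union> B (Q - D)" "{..<R}"] by (auto simp: B_def)
  then obtain b where b: "b < R" "b \<notin> B P" "b \<notin> B (Q - D)" by auto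
  define TP TQ where "TP = {u\<in>U. \<exists>x\<in>P. \<pi> a (x b) = \<pi> a u}"
    and "TQ = {u\<in>U. \<exists>x\<in>Q - D. \<pi> a (x b) = \<pi> a u}"
  have "TP \<inter> TQ \<noteq> {}"
  proof
    assume "TP \<inter> TQ = {}"
    then have "card TP + card TQ = card (TP \<union> TQ)"
      using finite_U by (subst card_Un_disjoint) (auto simp: TP_def TQ_def)
    also have "\<dots> \<le> card U" using finite_U by (intro card_mono) (auto simp: TP_def TQ_def)
    finally show False using b by (simp add: B_def TP_def TQ_def)
  qed
  then obtain u p w where u: "u \<in> U" "p \<in> P" "\<pi> a (p b) = \<pi> a u" "w \<in> Q" "w \<notin> D" "\<pi> a (w b) = \<pi> a u"
    unfolding TP_def TQ_def by auto
  have "w \<in> Y b (\<pi> a u)" using u Q by (auto simp: Y_def cyl_def)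
  then have "\<pi> a u \<notin> light b" using u b by (auto simp: D_def)
  then have "R * card (cyl a b (\<pi> a u)) < q * card (Y b (\<pi> a u))"
    using u by (auto simp: light_def)
  then have "\<exists>w\<in>Y b (\<pi> a u). (\<Sum>c<R. agree (p c) (w c)) = a"
    using u P b by (intro exact_agreement_in_cyl a) (auto simp: Y_def)
  then show ?thesis using u by (auto simp: Y_def)
qed

end

end

section \<open>Words of bits and base \<open>q\<close> letters\<close>

text \<open>Dividing by \<open>q ^ (K - i)\<close> keeps the \<open>i\<close> leading ones of
  \<open>K\<close> digits. Such a prefix has exactly \<open>q ^ (K - i)\<close> extensions, so
  branching holds with equality.\<close>

lemma prefix_system_digits:
  assumes q: "q > 0"
  shows "prefix_system {..<q ^ K} (\<lambda>i u. u div q ^ (K - i)) q K"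
proof -
  have fib: "card {u'\<in>{..<q ^ K}. u' div q ^ (K - i) = u div q ^ (K - i)} = q ^ (K - i)"
    if u: "u < q ^ K" and i: "i \<le> K" for u i
  proof -
    let ?d = "q ^ (K - i)" let ?v = "u div ?d"
    have d: "?d > 0" using q by simp
    have K: "q ^ K = q ^ i * ?d" using i by (simp flip: power_add)
    have "?v < q ^ i" using u K d by (simp add: less_mult_imp_div_less)
    then have le: "(?v + 1) * ?d \<le> q ^ K" unfolding K by (intro mult_right_mono) auto
    have iff: "u' div ?d = ?v \<longleftrightarrow> ?v * ?d \<le> u' \<and> u' < (?v + 1) * ?d" for u'
      unfolding less_eq_div_iff_mult_less_eq[OF d, symmetric] div_less_iff_less_mult[OF d, symmetric]
      by linarith
    have "{u'\<in>{..<q ^ K}. u' div ?d = ?v} = {?v * ?d..<(?v + 1) * ?d}"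
      unfolding iff using le less_le_trans by fastforce
    then show ?thesis by simp
  qed
  show ?thesis
  proof
    fix u u' a
    assume u: "u \<in> {..<q ^ K}" "u' \<in> {..<q ^ K}" and a: "a < K"
      and eq: "u div q ^ (K - Suc a) = u' div q ^ (K - Suc a)"
    have "q ^ (K - a) = q ^ (K - Suc a) * q"
      using a by (metis Suc_diff_Suc power_Suc2)
    then show "u div q ^ (K - a) = u' div q ^ (K - a)"
      using eq by (simp add: div_mult2_eq)
  next
    fix u a assume "u \<in> {..<q ^ K}" "a < K"
    moreover from this have "q ^ (K - a) = q * q ^ (K - Suc a)"
      by (metis Suc_diff_Suc power_Suc)
    ultimately show "q * card {u'\<in>{..<q ^ K}. u' div q ^ (K - Suc a) = u div q ^ (K - Suc a)}
        \<le> card {u'\<in>{..<q ^ K}. u' div q ^ (K - a) = u div q ^ (K - a)}"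
      using fib[of u "Suc a"] fib[of u a] by simp
  qed (use q in \<open>auto simp: lessThan_empty_iff\<close>)
qed

text \<open>A vertex consists of \<open>N\<close> bits and of \<open>R\<close> letters from \<open>{..<q ^ K}\<close>; two vertices are compared in
  their bits and in the \<open>K\<close> nonempty prefixes of the base \<open>q\<close> expansion of each letter.\<close>

definition mixed_words :: "nat \<Rightarrow> nat \<Rightarrow> nat \<Rightarrow> nat \<Rightarrow> (nat set \<times> (nat \<Rightarrow> nat)) set" where
  "mixed_words N R q K = Pow {..<N} \<times> ({..<R} \<rightarrow>\<^sub>E {..<q ^ K})"

definition agreements ::
    "nat \<Rightarrow> nat \<Rightarrow> nat \<Rightarrow> nat \<Rightarrow> nat set \<times> (nat \<Rightarrow> nat) \<Rightarrow> nat set \<times> (nat \<Rightarrow> nat) \<Rightarrow> nat" where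
  "agreements N R q K x y = card {i\<in>{..<N}. i \<in> fst x \<longleftrightarrow> i \<in> fst y} +
     (\<Sum>c<R. card {i\<in>{1..K}. snd x c div q ^ (K - i) = snd y c div q ^ (K - i)})"

lemma finite_mixed_words: "finite (mixed_words N R q K)"
  by (simp add: mixed_words_def finite_PiE)

text \<open>Most of the weight is in the bits, where dense sets have nearly antipodal pairs; the letters
  make up for the missing agreements exactly.\<close>

lemma dense_imp_exact_agreement:
  fixes L n :: nat
  defines "N \<equiv> L * n\<^sup>2" and "K \<equiv> L * n" and "R \<equiv> 4 * L"
  defines "q \<equiv> 2 * L * R\<^sup>2"
  assumes L: "L > 0" and n: "n > 0" and A: "A \<subseteq> mixed_words N R q K"
    and dens: "2 * card (mixed_words N R q K) \<le> L * card A"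
  shows "\<exists>x\<in>A. \<exists>y\<in>A. agreements N R q K x y = K"
proof -
  define W where "W = {..<R} \<rightarrow>\<^sub>E {..<q ^ K}"
  have q: "q > 0" using L by (simp add: q_def R_def)
  interpret prefix_system "{..<q ^ K}" "\<lambda>i u. u div q ^ (K - i)" q K
    using q by (rule prefix_system_digits)
  have fW: "finite W" by (simp add: W_def finite_PiE)
  have W0: "card W > 0" using q by (simp add: W_def card_PiE)
  define fibre where "fibre S = {w. (S, w) \<in> A}" for S
  have fib: "fibre S \<subseteq> W" for S using A by (auto simp: fibre_def mixed_words_def W_def)
  \<comment> \<open>The remaining fibres contribute at most density \<open>1 / L\<close> to the
    density \<open>2 / L\<close> of \<open>A\<close>, so \<open>A'\<close> has density at least
    \<open>1 / L\<close> in the cube.\<close>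
  define A' where "A' = {S\<in>Pow {..<N}. card W \<le> L * card (fibre S)}"
  have "A = Sigma (Pow {..<N}) fibre" using A by (auto simp: fibre_def mixed_words_def)
  then have "card A = (\<Sum>S\<in>Pow {..<N}. card (fibre S))"
    using finite_subset[OF fib fW] by simp
  then have "L * card A = (\<Sum>S\<in>Pow {..<N}. L * card (fibre S))"
    by (simp add: sum_distrib_left)
  also have "\<dots> \<le> (\<Sum>S\<in>Pow {..<N}. (if S \<in> A' then L * card W else 0) + card W)"
  proof (rule sum_mono)
    fix S assume S: "S \<in> Pow {..<N}"
    show "L * card (fibre S) \<le> (if S \<in> A' then L * card W else 0) + card W"
      using S card_mono[OF fW fib[of S]] by (auto simp: A'_def intro: trans_le_add1)
  qed
  also have "\<dots> = card A' * (L * card W) + 2 ^ N * card W"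
  proof -
    have "Pow {..<N} \<inter> {S. S \<in> A'} = A'" by (auto simp: A'_def)
    then show ?thesis by (simp add: sum.distrib card_Pow sum.If_cases)
  qed
  finally have "L * card A \<le> card A' * (L * card W) + 2 ^ N * card W" .
  moreover have "2 * (2 ^ N * card W) \<le> L * card A"
    using dens by (simp add: mixed_words_def W_def card_cartesian_product card_Pow)
  moreover have "card A' * (L * card W) = card W * (L * card A')" "2 ^ N * card W = card W * 2 ^ N"
    by simp_all
  ultimately have "card W * 2 ^ N \<le> card W * (L * card A')" by linarith
  then have "2 ^ N \<le> L * card A'" using W0 by simp
  \<comment> \<open>An equality: the deviation scale \<open>sqrt (L * N)\<close> is exactly
    \<open>K\<close>, yet \<open>K\<close> is only the fraction \<open>1 / n\<close> of the
    bits.\<close>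
  moreover have "L * N \<le> K\<^sup>2" by (simp add: N_def K_def power2_eq_square)
  ultimately obtain S T where ST: "S \<in> A'" "T \<in> A'"
    and j: "card {i\<in>{..<N}. i \<in> S \<longleftrightarrow> i \<in> T} \<le> K" (is "?j \<le> K")
    using nearly_antipodal_pair[of A' N L K] by (auto simp: A'_def)
  \<comment> \<open>The bits agree in \<open>?j\<close> places; \<open>exact_agreement\<close> with
    \<open>R' = 2 * L\<close> supplies the rest.\<close>
  have "\<exists>p\<in>fibre S. \<exists>w\<in>fibre T. (\<Sum>c<R. agree (p c) (w c)) = K - ?j"
  proof (rule exact_agreement)
    show "2 * L < 2 ^ (2 * L)" by (rule less_exp)
    show "2 * (2 * L) \<le> R" by (simp add: R_def)
    show "2 * L * R\<^sup>2 \<le> q" by (simp add: q_def)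
    show "fibre S \<subseteq> {..<R} \<rightarrow>\<^sub>E {..<q ^ K}" "fibre T \<subseteq> {..<R} \<rightarrow>\<^sub>E {..<q ^ K}"
      using fib by (auto simp: W_def)
    show "card ({..<R} \<rightarrow>\<^sub>E {..<q ^ K}) \<le> L * card (fibre S)"
      "card ({..<R} \<rightarrow>\<^sub>E {..<q ^ K}) \<le> L * card (fibre T)"
      using ST by (auto simp: A'_def W_def)
  qed simp
  then obtain p w where "p \<in> fibre S" "w \<in> fibre T" "(\<Sum>c<R. agree (p c) (w c)) = K - ?j"
    by blast
  then have "(S, p) \<in> A" "(T, w) \<in> A" "agreements N R q K (S, p) (T, w) = K"
    using j by (auto simp: fibre_def agreements_def agree_def)
  then show ?thesis by blast
qed

section \<open>Gram kernels and feasible solutions\<close>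

text \<open>Positive semidefinite kernels given by a finite feature map. With natural numbers as
  coordinates, sums and products of kernels are encoded by the standard bijections and features
  become vectors.\<close>

definition gram_on :: "'a set \<Rightarrow> ('a \<Rightarrow> 'a \<Rightarrow> real) \<Rightarrow> bool" where
  "gram_on V k \<longleftrightarrow> (\<exists>(I :: nat set) f. finite I \<and> (\<forall>x\<in>V. \<forall>y\<in>V. k x y = (\<Sum>i\<in>I. f x i * f y i)))"

lemma gram_onI:
  fixes I :: "nat set"
  assumes "finite I" "\<And>x y. x \<in> V \<Longrightarrow> y \<in> V \<Longrightarrow> k x y = (\<Sum>i\<in>I. f x i * f y i)"
  shows "gram_on V k"
  unfolding gram_on_def using assms by (intro exI[of _ I] exI[of _ f]) auto

lemma gram_on_sym: "gram_on V k \<Longrightarrow> x \<in> V \<Longrightarrow> y \<in> V \<Longrightarrow> k x y = k y x"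
  unfolding gram_on_def by (auto simp: mult.commute)

lemma gram_on_pullback:
  assumes "gram_on V k" "h ` S \<subseteq> V"
  shows "gram_on S (\<lambda>x y. k (h x) (h y))"
proof -
  obtain I :: "nat set" and f where "finite I" "\<forall>x\<in>V. \<forall>y\<in>V. k x y = (\<Sum>i\<in>I. f x i * f y i)"
    using assms(1) unfolding gram_on_def by blast
  then show ?thesis using assms(2) by (intro gram_onI[of I _ _ "\<lambda>x. f (h x)"]) auto
qed

lemma gram_on_rank_one: "gram_on V (\<lambda>x y. g x * g y)"
  by (rule gram_onI[of "{0}" _ _ "\<lambda>x _. g x"]) auto

text \<open>Schur product: the feature vectors are tensored.\<close>

lemma gram_on_mult:
  assumes "gram_on V k" "gram_on V l"
  shows "gram_on V (\<lambda>x y. k x y * l x y)"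
proof -
  obtain I :: "nat set" and f where I: "finite I" "\<forall>x\<in>V. \<forall>y\<in>V. k x y = (\<Sum>i\<in>I. f x i * f y i)"
    using assms(1) unfolding gram_on_def by blast
  obtain J :: "nat set" and g where J: "finite J" "\<forall>x\<in>V. \<forall>y\<in>V. l x y = (\<Sum>j\<in>J. g x j * g y j)"
    using assms(2) unfolding gram_on_def by blast
  show ?thesis
  proof (rule gram_onI[of "prod_encode ` (I \<times> J)"])
    fix x y assume xy: "x \<in> V" "y \<in> V"
    define h where "h x n = (case prod_decode n of (i, j) \<Rightarrow> f x i * g x j)" for x n
    have "(\<Sum>n\<in>prod_encode ` (I \<times> J). h x n * h y n) = (\<Sum>(i, j)\<in>I \<times> J. (f x i * f y i) * (g x j * g y j))"
      by (subst sum.reindex) (auto simp: inj_prod_encode h_def intro!: sum.cong)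
    also have "\<dots> = k x y * l x y"
      using I J xy by (simp add: sum_product sum.cartesian_product)
    finally show "k x y * l x y = (\<Sum>n\<in>prod_encode ` (I \<times> J).
        (case prod_decode n of (i, j) \<Rightarrow> f x i * g x j) * (case prod_decode n of (i, j) \<Rightarrow> f y i * g y j))"
      by (simp add: h_def)
  qed (use I J in auto)
qed

lemma gram_on_add:
  assumes "gram_on V k" "gram_on V l"
  shows "gram_on V (\<lambda>x y. k x y + l x y)"
proof -
  obtain I :: "nat set" and f where I: "finite I" "\<forall>x\<in>V. \<forall>y\<in>V. k x y = (\<Sum>i\<in>I. f x i * f y i)"
    using assms(1) unfolding gram_on_def by blast
  obtain J :: "nat set" and g where J: "finite J" "\<forall>x\<in>V. \<forall>y\<in>V. l x y = (\<Sum>j\<in>J. g x j * g y j)"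
    using assms(2) unfolding gram_on_def by blast
  show ?thesis
  proof (rule gram_onI[of "sum_encode ` (I <+> J)"])
    fix x y assume xy: "x \<in> V" "y \<in> V"
    define h where "h x n = case_sum (f x) (g x) (sum_decode n)" for x n
    have "(\<Sum>n\<in>sum_encode ` (I <+> J). h x n * h y n) = (\<Sum>z\<in>I <+> J. case_sum (f x) (g x) z * case_sum (f y) (g y) z)"
      by (subst sum.reindex) (auto simp: inj_sum_encode h_def)
    also have "\<dots> = k x y + l x y"
      using I J xy by (simp add: sum.Plus)
    finally show "k x y + l x y = (\<Sum>n\<in>sum_encode ` (I <+> J).
        case_sum (f x) (g x) (sum_decode n) * case_sum (f y) (g y) (sum_decode n))"
      by (simp add: h_def)
  qed (use I J in auto)
qed

lemma gram_on_const: "c \<ge> 0 \<Longrightarrow> gram_on V (\<lambda>_ _. c)"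
  using gram_on_rank_one[of V "\<lambda>_. sqrt c"] by simp

lemma gram_on_scale: "c \<ge> 0 \<Longrightarrow> gram_on V k \<Longrightarrow> gram_on V (\<lambda>x y. c * k x y)"
  by (rule gram_on_mult[OF gram_on_const])

lemma gram_on_sum:
  assumes "\<And>j. j \<in> J \<Longrightarrow> gram_on V (k j)"
  shows "gram_on V (\<lambda>x y. \<Sum>j\<in>J. k j x y)"
  using assms
proof (induction J rule: infinite_finite_induct)
  case (insert j J)
  then show ?case by (simp add: gram_on_add)
qed (simp_all add: gram_on_const)

lemma gram_on_power: "gram_on V k \<Longrightarrow> gram_on V (\<lambda>x y. k x y ^ r)"
  by (induction r) (simp_all add: gram_on_const gram_on_mult)

lemma gram_on_equality:
  fixes \<phi> :: "'a \<Rightarrow> nat"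
  assumes "finite V"
  shows "gram_on V (\<lambda>x y. of_bool (\<phi> x = \<phi> y))"
proof (rule gram_onI[of "\<phi> ` V" _ _ "\<lambda>x i. of_bool (\<phi> x = i)"])
  fix x y assume "x \<in> V" "y \<in> V"
  have "(\<Sum>i\<in>\<phi> ` V. of_bool (\<phi> x = i) * of_bool (\<phi> y = i)) =
      (\<Sum>i\<in>\<phi> ` V. if i = \<phi> x then of_bool (\<phi> x = \<phi> y) else (0::real))"
    by (rule sum.cong) auto
  also have "\<dots> = of_bool (\<phi> x = \<phi> y)" using assms \<open>x \<in> V\<close> by (simp add: sum.delta)
  finally show "of_bool (\<phi> x = \<phi> y) = (\<Sum>i\<in>\<phi> ` V. of_bool (\<phi> x = i) * of_bool (\<phi> y = i) :: real)" by simp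
qed (use assms in auto)

lemma gram_on_option:
  assumes "gram_on V k"
  shows "gram_on (insert None (Some ` V))
    (\<lambda>i j. case i of None \<Rightarrow> 0 | Some x \<Rightarrow> (case j of None \<Rightarrow> 0 | Some y \<Rightarrow> k x y))"
proof -
  obtain I :: "nat set" and f where "finite I" "\<forall>x\<in>V. \<forall>y\<in>V. k x y = (\<Sum>i\<in>I. f x i * f y i)"
    using assms(1) unfolding gram_on_def by blast
  then show ?thesis
    by (intro gram_onI[of I _ _ "\<lambda>i. case i of None \<Rightarrow> \<lambda>_. 0 | Some x \<Rightarrow> f x"]) (auto split: option.splits)
qed

lemma gram_on_imp_vectors:
  assumes "gram_on V k"
  shows "\<exists>m v. \<forall>x\<in>V. v x \<in> carrier_vec m \<and> (\<forall>y\<in>V. v x \<bullet> v y = k x y)"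
proof -
  obtain I :: "nat set" and f where I: "finite I" "\<forall>x\<in>V. \<forall>y\<in>V. k x y = (\<Sum>i\<in>I. f x i * f y i)"
    using assms(1) unfolding gram_on_def by blast
  obtain m where m: "I \<subseteq> {..<m}" using I(1) finite_nat_iff_bounded by auto
  define v where "v x = vec m (\<lambda>i. if i \<in> I then f x i else 0)" for x
  have "v x \<bullet> v y = k x y" if "x \<in> V" "y \<in> V" for x y
  proof -
    have "v x \<bullet> v y = (\<Sum>i<m. if i \<in> I then f x i * f y i else 0)"
      by (auto simp: v_def scalar_prod_def atLeast0LessThan intro!: sum.cong)
    also have "\<dots> = (\<Sum>i\<in>I. f x i * f y i)"
      using m by (simp add: sum.If_cases Int_absorb1)
    finally show ?thesis using I that by simp
  qed
  then show ?thesis by (intro exI[of _ m] exI[of _ v]) (auto simp: v_def)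
qed

section \<open>Feasible solutions, the optimum and vertex covers\<close>

text \<open>On unit vectors all constraints are affine in the inner products. Two inequalities give
  the three families of triangle constraints, as the mixed one is the first with \<open>j\<close>
  and \<open>l\<close> exchanged.\<close>

lemma sdp_feasible_of_gram:
  fixes G :: "'a pair_pre_digraph"
  assumes gram: "gram_on (sdp_index G) k"
    and unit: "\<And>i. i \<in> sdp_index G \<Longrightarrow> k i i = 1"
    and arcs: "\<And>i j. (i, j) \<in> parcs G \<Longrightarrow> i \<in> pverts G \<and> j \<in> pverts G \<and>
      1 + k (Some i) (Some j) = k None (Some i) + k None (Some j)"
    and tri: "\<And>i j l. i \<in> sdp_index G \<Longrightarrow> j \<in> sdp_index G \<Longrightarrow> l \<in> sdp_index G \<Longrightarrow>
      k i l + k j l \<le> 1 + k i j \<and> 0 \<le> 1 + k i j + k i l + k j l"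
  shows "\<exists>m v. sdp_feasible G m v \<and> (\<forall>i\<in>sdp_index G. \<forall>j\<in>sdp_index G. v i \<bullet> v j = k i j)"
proof -
  obtain m v where v: "\<And>i. i \<in> sdp_index G \<Longrightarrow> v i \<in> carrier_vec m"
    and k: "\<And>i j. i \<in> sdp_index G \<Longrightarrow> j \<in> sdp_index G \<Longrightarrow> v i \<bullet> v j = k i j"
    using gram_on_imp_vectors[OF gram] by blast
  have sym: "k i j = k j i" if "i \<in> sdp_index G" "j \<in> sdp_index G" for i j
    using gram_on_sym[OF gram that] .
  have expand:
    "(v i - v l) \<bullet> (v j - v l) = 1 + k i j - k i l - k j l"
    "(v i + v l) \<bullet> (v j - v l) = k i j - k i l + k j l - 1"
    "(v i + v l) \<bullet> (v j + v l) = 1 + k i j + k i l + k j l"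
    if "i \<in> sdp_index G" "j \<in> sdp_index G" "l \<in> sdp_index G" for i j l
  proof -
    note c = that[THEN v]
    have d: "v i - v l \<in> carrier_vec m" "v i + v l \<in> carrier_vec m" using c by auto
    note e = scalar_prod_add_distrib[OF d(2) c(2,3)] scalar_prod_minus_distrib[OF d(1) c(2,3)]
      scalar_prod_minus_distrib[OF d(2) c(2,3)]
      minus_scalar_prod_distrib[OF c(1,3,2)] minus_scalar_prod_distrib[OF c(1,3,3)]
      add_scalar_prod_distrib[OF c(1,3,2)] add_scalar_prod_distrib[OF c(1,3,3)]
    show "(v i - v l) \<bullet> (v j - v l) = 1 + k i j - k i l - k j l"
      "(v i + v l) \<bullet> (v j - v l) = k i j - k i l + k j l - 1"
      "(v i + v l) \<bullet> (v j + v l) = 1 + k i j + k i l + k j l"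
      using that by (simp_all add: e k unit sym[of l j])
  qed
  have "triangle_constraints (sdp_index G) v"
    unfolding triangle_constraints_def
  proof (intro ballI conjI)
    fix i j l assume "i \<in> sdp_index G" "j \<in> sdp_index G" "l \<in> sdp_index G"
    then show "(v i - v l) \<bullet> (v j - v l) \<ge> 0" "(v i + v l) \<bullet> (v j - v l) \<le> 0"
      "(v i + v l) \<bullet> (v j + v l) \<ge> 0"
      using tri[of i j l] tri[of i l j] sym[of l j] by (simp_all add: expand)
  qed
  moreover have "(v (Some i) - v None) \<bullet> (v (Some j) - v None) = 0" if "(i, j) \<in> parcs G" for i j
  proof -
    have "Some i \<in> sdp_index G" "Some j \<in> sdp_index G" "None \<in> sdp_index G"
      using arcs[OF that] by (auto simp: sdp_index_def)
    then show ?thesis using arcs[OF that] sym[of None] by (simp add: expand)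
  qed
  ultimately have "sdp_feasible G m v"
    using v k unit by (auto simp: sdp_feasible_def eucl_norm_def)
  then show ?thesis using k by blast
qed

lemma OPT_le_of_feasible: "sdp_feasible G m v \<Longrightarrow> OPT G \<le> sdp_value G v"
  unfolding OPT_def by (rule cInf_lower[OF _ sdp_values_bdd_below]) blast

lemma OPT_nonneg: "OPT G \<ge> 0"
  unfolding OPT_def
proof (rule cInf_greatest[OF sdp_values_nonempty])
  fix t assume "t \<in> {sdp_value G v | m v. sdp_feasible G m v}"
  then obtain m v where t: "t = sdp_value G v" and f: "sdp_feasible G m v" by blast
  have "1 + v None \<bullet> v (Some i) \<ge> 0" if "i \<in> pverts G" for i
  proof -
    have c: "v None \<in> carrier_vec m" "v (Some i) \<in> carrier_vec m"
      and n: "v None \<bullet> v None = 1" "v (Some i) \<bullet> v (Some i) = 1"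
      and tri: "(v None + v (Some i)) \<bullet> (v None + v (Some i)) \<ge> 0"
      using f that by (auto simp: sdp_feasible_def sdp_index_def eucl_norm_def scalar_prod_self_nonneg)
    have "(v None + v (Some i)) \<bullet> (v None + v (Some i)) = 2 + 2 * (v None \<bullet> v (Some i))"
      using c by (simp add: scalar_prod_add_distrib[of _ m] add_scalar_prod_distrib[of _ m] n
          comm_scalar_prod[of "v (Some i)" m "v None"])
    with tri show ?thesis by linarith
  qed
  then show "0 \<le> t" by (simp add: t sdp_value_def sum_nonneg)
qed

text \<open>The complement of a minimum vertex cover is independent.\<close>

lemma vc_lower_bound:
  fixes G :: "'a pair_pre_digraph"
  assumes "finite (pverts G)"
    and indep: "\<And>A. A \<subseteq> pverts G \<Longrightarrow> \<forall>i\<in>A. \<forall>j\<in>A. (i, j) \<notin> parcs G \<Longrightarrow> real (card A) < d"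
    and "parcs G \<subseteq> pverts G \<times> pverts G"
  shows "real (card (pverts G)) - d < vc G"
proof -
  have "vertex_cover G (pverts G)" using assms(3) by (auto simp: vertex_cover_def)
  then have "\<exists>C. vertex_cover G C \<and> card C = vc G"
    unfolding vc_def
    by (intro LeastI[where P = "\<lambda>k. \<exists>C. vertex_cover G C \<and> card C = k" and k = "card (pverts G)"]) blast
  then obtain C where C: "C \<subseteq> pverts G" "vertex_cover G C" "card C = vc G"
    by (auto simp: vertex_cover_def)
  then have "real (card (pverts G - C)) < d"
    by (intro indep) (auto simp: vertex_cover_def)
  moreover have "card (pverts G - C) = card (pverts G) - card C"
    using C assms(1) by (simp add: card_Diff_subset finite_subset)
  ultimately show ?thesis using C(3) by linarith
qed

section \<open>Triangle kernels under polynomials\<close>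

text \<open>In the main case \<open>u\<close> is below \<open>v\<close> and \<open>w\<close>.
  Factoring \<open>v ^ n - u ^ n\<close> and \<open>1 - w ^ n\<close>, the bounds
  \<open>v - u \<le> 1 - w\<close>, \<open>u \<le> w\<close> and \<open>v \<le> 1\<close> compare
  the factors termwise.\<close>

lemma sum_powers_le:
  fixes u v w :: real
  assumes "0 \<le> u" "0 \<le> v" "0 \<le> w" "u \<le> 1" "v \<le> 1" "w \<le> 1" "v + w \<le> 1 + u"
  shows "v ^ n + w ^ n \<le> 1 + u ^ n"
proof (cases "v \<le> u \<or> w \<le> u")
  case True
  then show ?thesis
    using assms power_mono[of v u n] power_mono[of w u n] power_le_one[of v n] power_le_one[of w n] by auto
next
  case False
  have "v ^ n - u ^ n = (v - u) * (\<Sum>i<n. u ^ (n - Suc i) * v ^ i)"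
    by (rule power_diff_sumr2)
  also have "\<dots> \<le> (1 - w) * (\<Sum>i<n. w ^ (n - Suc i) * 1 ^ i)"
    using assms False by (intro mult_mono sum_mono power_mono sum_nonneg) auto
  also have "\<dots> = 1 ^ n - w ^ n" by (rule power_diff_sumr2[symmetric])
  finally show ?thesis by simp
qed

text \<open>Bernoulli's inequality at \<open>x / y\<close>, rescaled by \<open>y ^ n\<close>;
  evenness admits all real \<open>x\<close>.\<close>

lemma even_power_ge_tangent:
  fixes x y :: real
  assumes "even n" "y \<noteq> 0"
  shows "y ^ n + n * y ^ (n - 1) * (x - y) \<le> x ^ n"
proof (cases n)
  case (Suc k)
  have "y ^ n * (1 + n * (x / y - 1)) \<le> y ^ n * (1 + (x / y - 1)) ^ n"
    using assms by (intro mult_left_mono Bernoulli_inequality_even zero_le_even_power)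
  also have "\<dots> = x ^ n" using assms by (simp add: power_divide)
  also have "y ^ n * (1 + n * (x / y - 1)) = y ^ n + n * y ^ (n - 1) * (x - y)"
    using assms Suc by (simp add: field_simps)
  finally show ?thesis .
qed simp

text \<open>Inner products of unit vectors with all triangle inequalities on the vectors and their
  antipodes; the mixed ones arise by permuting \<open>x\<close>, \<open>y\<close>,
  \<open>z\<close>.\<close>

definition triangle_kernel :: "'a set \<Rightarrow> ('a \<Rightarrow> 'a \<Rightarrow> real) \<Rightarrow> bool" where
  "triangle_kernel V t \<longleftrightarrow> gram_on V t \<and> (\<forall>x\<in>V. t x x = 1) \<and>
     (\<forall>x\<in>V. \<forall>y\<in>V. \<forall>z\<in>V. t x z + t y z \<le> 1 + t x y \<and> 0 \<le> 1 + t x y + t x z + t y z)"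

text \<open>The four sign cases of the last inequality are permuted instances of the first two. It
  makes \<open>sum_powers_le\<close> applicable to even powers of \<open>t\<close>.\<close>

lemma triangle_kernelD:
  assumes "triangle_kernel V t" "x \<in> V" "y \<in> V" "z \<in> V"
  shows "t x z + t y z \<le> 1 + t x y" "0 \<le> 1 + t x y + t x z + t y z"
    "\<bar>t x y\<bar> \<le> 1" "\<bar>t x z\<bar> + \<bar>t y z\<bar> \<le> 1 + \<bar>t x y\<bar>"
proof -
  have tri: "t x z + t y z \<le> 1 + t x y" "0 \<le> 1 + t x y + t x z + t y z"
    if "x \<in> V" "y \<in> V" "z \<in> V" for x y z
    using assms(1) that by (auto simp: triangle_kernel_def)
  have sym: "t x y = t y x" if "x \<in> V" "y \<in> V" for x y
    using assms(1) that gram_on_sym by (auto simp: triangle_kernel_def)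
  have unit: "t x x = 1" if "x \<in> V" for x using assms(1) that by (auto simp: triangle_kernel_def)
  note a = assms(2-4)
  show "t x z + t y z \<le> 1 + t x y" "0 \<le> 1 + t x y + t x z + t y z" using tri a by auto
  show "\<bar>t x y\<bar> \<le> 1"
    using tri[of x x y] a unit by (auto simp: abs_le_iff)
  show "\<bar>t x z\<bar> + \<bar>t y z\<bar> \<le> 1 + \<bar>t x y\<bar>"
    using tri[OF a] tri(1)[OF a(1,3,2)] tri(1)[OF a(2,3,1)]
    unfolding sym[OF a(3,2)] sym[OF a(3,1)] sym[OF a(2,1)] by linarith
qed

text \<open>Near \<open>- 1\<close>, the polynomial \<open>p t = (1 - \<beta>) t + \<beta> t ^ r\<close> has its minimum on the edges for the right
  choice of \<open>\<beta>\<close>, which is what the triangle inequalities involving \<open>v\<^sub>0\<close> require. The inner products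
  \<open>s\<^sup>2 + (1 - s\<^sup>2) p t\<close> are those of \<open>s v\<^sub>0 + sqrt (1 - s\<^sup>2) w\<close> with \<open>w \<bottom> v\<^sub>0\<close>, and \<open>s\<close> is
  determined by the edge constraint.\<close>

lemma OPT_le_triangle_kernel:
  fixes G :: "'a pair_pre_digraph" and r :: nat and t0 :: real
  assumes l1: "triangle_kernel (pverts G) t"
    and arcs: "\<And>i j. (i, j) \<in> parcs G \<Longrightarrow> i \<in> pverts G \<and> j \<in> pverts G \<and> t i j = t0"
    and r: "even r" "r \<ge> 6" and t0: "-1 \<le> t0" "t0 \<le> -1 + 1 / (2 * r)"
  shows "OPT G \<le> card (pverts G) * ((1 + 5 / r) / 2)"
proof -
  define a where "a = - t0"
  \<comment> \<open>Makes the derivative of \<open>p\<close> vanish at \<open>t0 = - a\<close>,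
    where it is \<open>(1 - \<beta>) - \<beta> * r * a ^ (r - 1)\<close> because
    \<open>r - 1\<close> is odd.\<close>
  define \<beta> where "\<beta> = 1 / (1 + r * a ^ (r - 1))"
  define p where "p x = (1 - \<beta>) * x + \<beta> * x ^ r" for x :: real
  define q where "q = - p t0"
  \<comment> \<open>The edge constraint \<open>s\<^sup>2 - (1 - s\<^sup>2) * q = 2 * s - 1\<close>,
    divided by \<open>1 - s\<close>, reads \<open>1 - s = (1 + s) * q\<close>.\<close>
  define s where "s = (1 - q) / (1 + q)"
  have r1: "1 / (2 * r) \<le> 1 / 12" using r by (simp add: field_simps)
  have a: "0 < a" "a \<le> 1" "1 - a \<le> 1 / (2 * r)" using t0 r1 by (auto simp: a_def)
  \<comment> \<open>As \<open>a\<close> is within \<open>1 / (2 * r)\<close> of 1, its power stays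
    above \<open>1 / 2\<close>, and so \<open>\<beta>\<close> is of order
    \<open>1 / r\<close>.\<close>
  have "1 / 2 \<le> 1 + real (r - 1) * (- 1 / (2 * r))"
    using r by (simp add: field_simps of_nat_diff)
  also have "\<dots> \<le> (1 + - 1 / (2 * r)) ^ (r - 1)"
    using r1 by (intro Bernoulli_inequality) simp
  also have "\<dots> \<le> a ^ (r - 1)" using a r1 by (intro power_mono) auto
  finally have half: "1 / 2 \<le> a ^ (r - 1)" .
  have pos: "0 < 1 + r * a ^ (r - 1)" using a by (simp add: add_pos_nonneg)
  have \<beta>: "0 < \<beta>" "\<beta> \<le> 1" "\<beta> \<le> 2 / r" "\<beta> * (r * a ^ (r - 1)) = 1 - \<beta>"
  proof -
    show "0 < \<beta>" using pos by (simp add: \<beta>_def)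
    have "0 \<le> r * a ^ (r - 1)" using a by simp
    then show "\<beta> \<le> 1" using pos by (simp add: \<beta>_def divide_le_eq_1)
    have "r / 2 \<le> 1 + r * a ^ (r - 1)" using mult_left_mono[OF half, of "real r"] by simp
    then have "1 / (1 + r * a ^ (r - 1)) \<le> 1 / (r / 2)"
      using r by (intro divide_left_mono mult_pos_pos pos) auto
    then show "\<beta> \<le> 2 / r" by (simp add: \<beta>_def)
    show "\<beta> * (r * a ^ (r - 1)) = 1 - \<beta>" using pos by (simp add: \<beta>_def field_simps)
  qed
  \<comment> \<open>The tangent of \<open>x ^ r\<close> at \<open>t0\<close>, scaled by
    \<open>\<beta>\<close>, has slope \<open>- (1 - \<beta>)\<close> and cancels the linear term of
    \<open>p\<close>.\<close>
  have p_min: "p t0 \<le> p x" for x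
  proof -
    have "t0 ^ (r - 1) = - (a ^ (r - 1))"
      using r by (simp add: a_def)
    then have "\<beta> * (r * t0 ^ (r - 1)) = - (1 - \<beta>)" using \<beta>(4) by simp
    then have "\<beta> * (r * t0 ^ (r - 1)) * (x - t0) = - (1 - \<beta>) * (x - t0)" by (rule arg_cong)
    then have "\<beta> * (t0 ^ r + r * t0 ^ (r - 1) * (x - t0)) = \<beta> * t0 ^ r - (1 - \<beta>) * (x - t0)"
      by (simp only: distrib_left mult.assoc)
    moreover have "\<beta> * (t0 ^ r + r * t0 ^ (r - 1) * (x - t0)) \<le> \<beta> * x ^ r"
      using r a \<beta> by (intro mult_left_mono even_power_ge_tangent) (auto simp: a_def)
    ultimately have "\<beta> * t0 ^ r - (1 - \<beta>) * (x - t0) \<le> \<beta> * x ^ r" by linarith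
    then show ?thesis by (simp add: p_def algebra_simps)
  qed
  have ev: "\<bar>u\<bar> ^ r = u ^ r" for u :: real using r(1) by (rule power_even_abs)
  have p_le: "p x \<le> 1" if x: "\<bar>x\<bar> \<le> 1" for x
  proof -
    have "x ^ r \<le> 1" using power_le_one[OF abs_ge_zero x, of r] ev by simp
    then have "p x \<le> (1 - \<beta>) * 1 + \<beta> * 1"
      unfolding p_def using \<beta>(1,2) x by (intro add_mono mult_left_mono) auto
    then show ?thesis by simp
  qed
  have q: "0 \<le> q" "q \<le> 1" "1 - q \<le> 5 / r"
  proof -
    have "t0 ^ r = a ^ r" using r by (simp add: a_def)
    then have eq: "1 - q = (1 - a) + \<beta> * (a + a ^ r)" by (simp add: q_def p_def a_def algebra_simps)
    have "\<beta> * (a + a ^ r) \<le> 2 / r * 2"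
      using \<beta> a power_le_one[of a r] by (intro mult_mono) auto
    then show le: "1 - q \<le> 5 / r" using a eq by (simp add: field_simps)
    have "0 \<le> \<beta> * (a + a ^ r)" using a(1) \<beta>(1) by simp
    then show "q \<le> 1" using eq a(2) by linarith
    have "5 / r \<le> 1" using r(2) by simp
    with le show "0 \<le> q" by linarith
  qed
  have s: "0 \<le> s" "s \<le> 1" "s \<le> 5 / r" "s\<^sup>2 + (1 - s\<^sup>2) * p t0 = 2 * s - 1"
  proof -
    show "0 \<le> s" "s \<le> 1" using q by (auto simp: s_def)
    have s_mult: "s * (1 + q) = 1 - q" using q by (simp add: s_def)
    have "0 \<le> s * q" using \<open>0 \<le> s\<close> q by simp
    then show "s \<le> 5 / r" using q s_mult by (simp add: algebra_simps)
    from s_mult have "(1 + s) * q = 1 - s" by (simp add: algebra_simps)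
    then have "(1 - s) * ((1 + s) * q) = (1 - s) * (1 - s)" by simp
    then show "s\<^sup>2 + (1 - s\<^sup>2) * p t0 = 2 * s - 1"
      by (simp add: q_def power2_eq_square algebra_simps)
  qed
  have s2: "s\<^sup>2 \<le> 1" using s power_le_one[of s 2] by simp
  define \<kappa> where "\<kappa> x = s\<^sup>2 + (1 - s\<^sup>2) * p x" for x
  \<comment> \<open>The triangle inequality centred at \<open>v\<^sub>0\<close>, with which every
    vertex has inner product \<open>s\<close>; equality at \<open>t0\<close> is the edge
    constraint.\<close>
  have \<kappa>_ge: "2 * s - 1 \<le> \<kappa> x" for x
    using mult_left_mono[OF p_min[of x], of "1 - s\<^sup>2"] s2 s(4) by (simp add: \<kappa>_def)
  have \<kappa>_le: "\<kappa> x \<le> 1" if "\<bar>x\<bar> \<le> 1" for x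
    using mult_left_mono[OF p_le[OF that], of "1 - s\<^sup>2"] s2 by (simp add: \<kappa>_def)
  have tri: "\<kappa> (t x z) + \<kappa> (t y z) \<le> 1 + \<kappa> (t x y)" "0 \<le> 1 + \<kappa> (t x y) + \<kappa> (t x z) + \<kappa> (t y z)"
    if V: "x \<in> pverts G" "y \<in> pverts G" "z \<in> pverts G" for x y z
  proof -
    note T = triangle_kernelD[OF l1 V] and Tb = triangle_kernelD(3)[OF l1]
    have pw: "t x z ^ r + t y z ^ r \<le> 1 + t x y ^ r"
      using sum_powers_le[of "\<bar>t x y\<bar>" "\<bar>t x z\<bar>" "\<bar>t y z\<bar>" r] T Tb V by (simp add: ev)
    have "(1 - \<beta>) * (t x z + t y z) + \<beta> * (t x z ^ r + t y z ^ r)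
        \<le> (1 - \<beta>) * (1 + t x y) + \<beta> * (1 + t x y ^ r)"
      by (rule add_mono[OF mult_left_mono[OF T(1)] mult_left_mono[OF pw]]) (use \<beta> in auto)
    then have "p (t x z) + p (t y z) \<le> 1 + p (t x y)"
      by (simp add: p_def algebra_simps)
    from mult_left_mono[OF this, of "1 - s\<^sup>2"]
    show "\<kappa> (t x z) + \<kappa> (t y z) \<le> 1 + \<kappa> (t x y)"
      using s2 by (simp add: \<kappa>_def algebra_simps)
    have ge: "- 1 \<le> t x y + t x z + t y z" "0 \<le> t x y ^ r + t x z ^ r + t y z ^ r"
      using T(2) r(1) by (simp_all add: add_nonneg_nonneg zero_le_even_power)
    have "(1 - \<beta>) * - 1 + \<beta> * 0 \<le> (1 - \<beta>) * (t x y + t x z + t y z) + \<beta> * (t x y ^ r + t x z ^ r + t y z ^ r)"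
      by (rule add_mono[OF mult_left_mono[OF ge(1)] mult_left_mono[OF ge(2)]]) (use \<beta> in auto)
    then have "- 1 \<le> p (t x y) + p (t x z) + p (t y z)"
      using \<beta> by (simp add: p_def algebra_simps)
    from mult_left_mono[OF this, of "1 - s\<^sup>2"]
    have "- (1 - s\<^sup>2) \<le> (1 - s\<^sup>2) * p (t x y) + (1 - s\<^sup>2) * p (t x z) + (1 - s\<^sup>2) * p (t y z)"
      using s2 by (simp add: algebra_simps)
    then show "0 \<le> 1 + \<kappa> (t x y) + \<kappa> (t x z) + \<kappa> (t y z)"
      using s2 zero_le_power2[of s] unfolding \<kappa>_def by linarith
  qed
  \<comment> \<open>A rank-one part along \<open>v\<^sub>0\<close> plus the Gram kernel of the
    orthogonal components.\<close>
  define k where "k i j = (case i of None \<Rightarrow> 1 | Some _ \<Rightarrow> s) * (case j of None \<Rightarrow> 1 | Some _ \<Rightarrow> s) +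
    (case i of None \<Rightarrow> 0 | Some x \<Rightarrow> (case j of None \<Rightarrow> 0 | Some y \<Rightarrow> (1 - s\<^sup>2) * p (t x y)))"
    for i j :: "'a option"
  have k_simps [simp]: "k None None = 1" "k None (Some y) = s" "k (Some x) None = s"
    "k (Some x) (Some y) = \<kappa> (t x y)" for x y
    by (simp_all add: k_def \<kappa>_def power2_eq_square)
  have unit: "t x x = 1" if "x \<in> pverts G" for x using l1 that by (simp add: triangle_kernel_def)
  have \<kappa>1: "\<kappa> 1 = 1" by (simp add: \<kappa>_def p_def)
  have "\<exists>m v. sdp_feasible G m v \<and> (\<forall>i\<in>sdp_index G. \<forall>j\<in>sdp_index G. v i \<bullet> v j = k i j)"
  proof (rule sdp_feasible_of_gram)
    have "gram_on (pverts G) t" using l1 by (simp add: triangle_kernel_def)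
    then have "gram_on (pverts G) (\<lambda>x y. (1 - s\<^sup>2) * p (t x y))"
      unfolding p_def using \<beta> s2 by (intro gram_on_scale gram_on_add gram_on_power) auto
    then show "gram_on (sdp_index G) k"
      unfolding sdp_index_def k_def by (intro gram_on_add gram_on_rank_one gram_on_option)
    show "k i i = 1" if "i \<in> sdp_index G" for i
      using that unit \<kappa>1 by (auto simp: sdp_index_def)
    show "i \<in> pverts G \<and> j \<in> pverts G \<and> 1 + k (Some i) (Some j) = k None (Some i) + k None (Some j)"
      if "(i, j) \<in> parcs G" for i j
      using arcs[OF that] s(4) by (simp add: \<kappa>_def)
    show "k i l + k j l \<le> 1 + k i j \<and> 0 \<le> 1 + k i j + k i l + k j l"
      if "i \<in> sdp_index G" "j \<in> sdp_index G" "l \<in> sdp_index G" for i j l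
    proof -
      have bd: "2 * s - 1 \<le> \<kappa> (t x y)" "\<kappa> (t x y) \<le> 1" if "x \<in> pverts G" "y \<in> pverts G" for x y
        using \<kappa>_ge \<kappa>_le triangle_kernelD(3)[OF l1] that by auto
      have mem: "x \<in> pverts G" if "Some x \<in> sdp_index G" for x
        using that by (auto simp: sdp_index_def)
      \<comment> \<open>Triples containing \<open>None\<close> need only
        \<open>0 \<le> s \<le> 1\<close> and \<open>bd\<close>; the others are
        \<open>tri\<close>.\<close>
      show ?thesis
      proof (cases i)
        case None
        then show ?thesis
          using that s(1,2) bd[of "the j" "the l"] by (cases j; cases l) (auto dest!: mem)
      next
        case (Some x)
        then show ?thesis
          using that s(1,2) bd[of x "the j"] bd[of x "the l"] tri[of x "the j" "the l"]
          by (cases j; cases l) (auto dest!: mem)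
      qed
    qed
  qed
  then obtain m v where f: "sdp_feasible G m v"
    and v: "\<And>i j. i \<in> sdp_index G \<Longrightarrow> j \<in> sdp_index G \<Longrightarrow> v i \<bullet> v j = k i j"
    by blast
  have "OPT G \<le> sdp_value G v" by (rule OPT_le_of_feasible[OF f])
  also have "\<dots> = (\<Sum>i\<in>pverts G. (1 + s) / 2)"
    unfolding sdp_value_def by (intro sum.cong) (auto simp: v sdp_index_def)
  also have "\<dots> \<le> card (pverts G) * ((1 + 5 / r) / 2)"
    using s(3) by (simp add: mult_left_mono)
  finally show ?thesis .
qed

section \<open>The integrality gap\<close>

lemma card_filter_eq_sum_of_bool:
  "finite A \<Longrightarrow> real (card {i\<in>A. P i}) = (\<Sum>i\<in>A. of_bool (P i))"
  by (simp add: sum_of_bool_eq Collect_conj_eq)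

lemma agreements_eq_sum:
  "real (agreements N R q K x y) = (\<Sum>i<N. of_bool (i \<in> fst x \<longleftrightarrow> i \<in> fst y)) +
    (\<Sum>c<R. \<Sum>i\<in>{1..K}. of_bool (snd x c div q ^ (K - i) = snd y c div q ^ (K - i)))"
  by (simp only: agreements_def of_nat_add of_nat_sum card_filter_eq_sum_of_bool finite_lessThan finite_atLeastAtMost)

lemma agreements_self: "agreements N R q K x x = N + R * K"
proof -
  have "{i \<in> {..<N}. True} = {..<N}" "{i \<in> {1..K}. True} = {1..K}" by auto
  then show ?thesis by (simp add: agreements_def)
qed

text \<open>Each bit counts \<open>1\<close> or \<open>- 1\<close> and each prefix \<open>2\<close>
  or \<open>0\<close>, so the kernel depends only on the number of agreements and is constant on
  edges; the denominator normalises the diagonal.\<close>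

definition word_kernel ::
    "nat \<Rightarrow> nat \<Rightarrow> nat \<Rightarrow> nat \<Rightarrow> nat set \<times> (nat \<Rightarrow> nat) \<Rightarrow> nat set \<times> (nat \<Rightarrow> nat) \<Rightarrow> real" where
  "word_kernel N R q K x y = (2 * real (agreements N R q K x y) - N) / (N + 2 * R * K)"

text \<open>The upper bound holds summand by summand: for signs by cases, for equality indicators by
  transitivity. In the lower bound the bits contribute at least \<open>- N\<close>, the prefixes
  nothing negative, and \<open>N\<close> is at most the denominator.\<close>

lemma triangle_kernel_word_kernel:
  assumes "N > 0"
  shows "triangle_kernel (mixed_words N R q K) (word_kernel N R q K)"
proof -
  define D where "D = real (N + 2 * R * K)"
  have "N + 2 * R * K > 0" using assms by simp
  then have D: "D > 0" unfolding D_def of_nat_0_less_iff .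
  define \<sigma> where "\<sigma> i x = (if i \<in> fst x then 1 else - 1 :: real)" for i and x :: "nat set \<times> (nat \<Rightarrow> nat)"
  define e where "e c i x y = (of_bool (snd x c div q ^ (K - i) = snd y c div q ^ (K - i)) :: real)"
    for c i and x y :: "nat set \<times> (nat \<Rightarrow> nat)"
  define a b where "a x y = (\<Sum>i<N. \<sigma> i x * \<sigma> i y)" and "b x y = (\<Sum>c<R. \<Sum>i\<in>{1..K}. e c i x y)" for x y
  have "\<sigma> i x * \<sigma> i y = 2 * of_bool (i \<in> fst x \<longleftrightarrow> i \<in> fst y) - 1" for i x y
    by (simp add: \<sigma>_def)
  then have rep: "word_kernel N R q K x y = 1 / D * (a x y + 2 * b x y)" for x y
    by (simp add: word_kernel_def agreements_eq_sum a_def b_def e_def D_def sum_subtractf sum_distrib_left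
        del: sum_of_bool_eq sum_mult_of_bool_eq)
  have "gram_on (mixed_words N R q K) (\<lambda>x y. 1 / D * (a x y + 2 * b x y))"
    unfolding a_def b_def e_def using D finite_mixed_words
    by (intro gram_on_scale gram_on_add gram_on_sum gram_on_rank_one gram_on_equality) auto
  moreover have "word_kernel N R q K x x = 1" for x
    using D by (simp add: word_kernel_def agreements_self D_def field_simps)
  moreover have "word_kernel N R q K x z + word_kernel N R q K y z \<le> 1 + word_kernel N R q K x y"
    "0 \<le> 1 + word_kernel N R q K x y + word_kernel N R q K x z + word_kernel N R q K y z" for x y z
  proof -
    have "0 \<le> (\<Sum>i<N. 1 + \<sigma> i x * \<sigma> i y - \<sigma> i x * \<sigma> i z - \<sigma> i y * \<sigma> i z)"
      by (rule sum_nonneg) (simp add: \<sigma>_def)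
    then have a: "a x z + a y z \<le> N + a x y"
      by (simp add: a_def sum.distrib sum_subtractf)
    have "0 \<le> (\<Sum>c<R. \<Sum>i\<in>{1..K}. 1 + e c i x y - e c i x z - e c i y z)"
      by (intro sum_nonneg) (simp add: e_def)
    then have b: "b x z + b y z \<le> R * K + b x y"
      by (simp add: b_def sum.distrib sum_subtractf)
    have "1 / D * (a x z + 2 * b x z + (a y z + 2 * b y z)) \<le> 1 / D * (D + (a x y + 2 * b x y))"
      using a b D by (intro mult_left_mono) (simp_all add: D_def)
    then show "word_kernel N R q K x z + word_kernel N R q K y z \<le> 1 + word_kernel N R q K x y"
      using D by (simp add: rep add_divide_distrib)
    have "0 \<le> (\<Sum>i<N. 1 + \<sigma> i x * \<sigma> i y + \<sigma> i x * \<sigma> i z + \<sigma> i y * \<sigma> i z)"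
      by (rule sum_nonneg) (simp add: \<sigma>_def)
    then have a: "0 \<le> N + a x y + a x z + a y z"
      by (simp add: a_def sum.distrib)
    have b: "0 \<le> b x y" for x y by (simp add: b_def e_def sum_nonneg)
    have "N \<le> D" by (simp add: D_def)
    then have "0 \<le> D + (a x y + 2 * b x y) + (a x z + 2 * b x z) + (a y z + 2 * b y z)"
      using a b[of x y] b[of x z] b[of y z] by linarith
    then have "1 / D * 0 \<le> 1 / D * (D + (a x y + 2 * b x y) + (a x z + 2 * b x z) + (a y z + 2 * b y z))"
      using D by (intro mult_left_mono) auto
    then show "0 \<le> 1 + word_kernel N R q K x y + word_kernel N R q K x z + word_kernel N R q K y z"
      using D by (simp add: rep add_divide_distrib)
  qed
  ultimately show ?thesis by (simp add: triangle_kernel_def rep[abs_def])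
qed

lemma triangle_kernel_pullback:
  assumes "triangle_kernel V t" "h ` S \<subseteq> V"
  shows "triangle_kernel S (\<lambda>x y. t (h x) (h y))"
  using assms gram_on_pullback[OF _ assms(2)] by (auto simp: triangle_kernel_def image_subset_iff)

lemma integrality_gap_graph:
  fixes L n r :: nat
  assumes L: "L > 0" and n: "n > 0" and r: "even r" "r \<ge> 6"
    and small: "(8 * L + 2) / (n + 8 * L) \<le> 1 / (2 * real r)"
  shows "\<exists>G :: nat pair_pre_digraph. pair_graph G \<and>
    (1 - 2 / L) * card (pverts G) < vc G \<and> OPT G \<le> card (pverts G) * ((1 + 5 / r) / 2)"
proof -
  define N K R q where "N = L * n\<^sup>2" and "K = L * n" and "R = 4 * L" and "q = 2 * L * R\<^sup>2"
  have N: "N > 0" using L n by (simp add: N_def)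
  define V where "V = mixed_words N R q K"
  obtain h where h: "bij_betw h {..<card V} V"
    using ex_bij_betw_nat_finite[OF finite_mixed_words[of N R q K]] unfolding V_def atLeast0LessThan by blast
  have hV: "h i \<in> V" if "i < card V" for i using h that by (auto simp: bij_betw_def)
  define G where "G = \<lparr>pverts = {..<card V},
    parcs = {(i, j). i < card V \<and> j < card V \<and> agreements N R q K (h i) (h j) = K}\<rparr>"
  define t0 where "t0 = (2 * real K - N) / (N + 2 * R * K)"
  have sym: "agreements N R q K x y = agreements N R q K y x" for x y
    unfolding agreements_def by (intro arg_cong2[of _ _ _ _ "(+)"] sum.cong arg_cong[of _ _ card]) auto
  have noloop: "agreements N R q K x x \<noteq> K" for x
  proof -
    have "K \<le> R * K" using L by (simp add: R_def)
    then show ?thesis using N unfolding agreements_self by linarith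
  qed
  have "pair_graph G"
  proof
    show "finite (parcs G)"
      by (rule finite_subset[of _ "{..<card V} \<times> {..<card V}"]) (auto simp: G_def)
    show "fst e \<noteq> snd e" if "e \<in> parcs G" for e
      using that noloop[of "h (fst e)"] by (auto simp: G_def)
    show "symmetric (with_proj G)"
      unfolding symmetric_def by (auto simp: G_def sym intro!: symI)
  qed (auto simp: G_def)
  moreover have "(1 - 2 / L) * card (pverts G) < vc G"
  proof -
    have "real (card (pverts G)) - 2 / L * card V < vc G"
    proof (rule vc_lower_bound)
      fix A assume A: "A \<subseteq> pverts G" and indep: "\<forall>i\<in>A. \<forall>j\<in>A. (i, j) \<notin> parcs G"
      have "\<not> 2 * card V \<le> L * card (h ` A)"
      proof
        assume "2 * card V \<le> L * card (h ` A)"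
        moreover have "h ` A \<subseteq> V" using A hV by (auto simp: G_def)
        ultimately have "\<exists>x\<in>h ` A. \<exists>y\<in>h ` A. agreements N R q K x y = K"
          unfolding V_def N_def K_def R_def q_def by (intro dense_imp_exact_agreement L n)
        then show False using A indep by (auto simp: G_def)
      qed
      moreover have "card (h ` A) = card A"
        using A h by (intro card_image) (auto simp: G_def bij_betw_def intro: inj_on_subset)
      ultimately have "real (L * card A) < real (2 * card V)" by (simp only: of_nat_less_iff)
      then show "real (card A) < 2 / L * card V" using L by (simp add: field_simps)
    qed (auto simp: G_def)
    then show ?thesis by (simp add: G_def algebra_simps)
  qed
  moreover have "OPT G \<le> card (pverts G) * ((1 + 5 / r) / 2)"
  proof (rule OPT_le_triangle_kernel[of G "\<lambda>i j. word_kernel N R q K (h i) (h j)" t0])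
    show "triangle_kernel (pverts G) (\<lambda>i j. word_kernel N R q K (h i) (h j))"
      using hV by (intro triangle_kernel_pullback[OF triangle_kernel_word_kernel[OF N]]) (auto simp: G_def V_def)
    show "i \<in> pverts G \<and> j \<in> pverts G \<and> word_kernel N R q K (h i) (h j) = t0"
      if "(i, j) \<in> parcs G" for i j
      using that by (auto simp: G_def word_kernel_def t0_def)
    \<comment> \<open>Cancelling \<open>L * n\<close> shows that the edges are at distance
      \<open>(8 * L + 2) / (n + 8 * L)\<close> from \<open>- 1\<close>, the quantity in
      \<open>small\<close>.\<close>
    have "real (N + 2 * R * K) = (L * n) * (n + 8 * L)" "2 * real K - N = (L * n) * (2 - real n)"
      by (simp_all add: N_def K_def R_def power2_eq_square algebra_simps)
    then have "t0 = (2 - real n) / (n + 8 * L)" using L n by (simp add: t0_def)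
    then have "t0 = - 1 + (8 * L + 2) / (n + 8 * L)" using n by (simp add: field_simps)
    then show "- 1 \<le> t0" "t0 \<le> - 1 + 1 / real (2 * r)" using small by auto
  qed (use r in auto)
  ultimately show ?thesis by blast
qed

theorem theorem4:
  fixes \<epsilon> :: real
  assumes "\<epsilon> > 0"
  shows "\<exists>G :: nat pair_pre_digraph. pair_graph G \<and> real (vc G) > (2 - \<epsilon>) * OPT G"
proof -
  \<comment> \<open>Capping at 1 keeps \<open>2 - \<delta>\<close> nonnegative, so the bound on
    \<open>OPT G\<close> may be multiplied by it.\<close>
  define \<delta> where "\<delta> = min \<epsilon> 1"
  have \<delta>: "0 < \<delta>" "\<delta> \<le> 1" "\<delta> \<le> \<epsilon>" using assms by (auto simp: \<delta>_def)
  obtain r0 :: nat where r0: "20 / \<delta> < r0" using reals_Archimedean2 by blast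
  define r where "r = 2 * r0"
  define L where "L = r0"
  have r0': "20 < r0"
  proof -
    have "20 \<le> 20 / \<delta>" using \<delta> by (simp add: field_simps)
    then show ?thesis using r0 by linarith
  qed
  have d: "2 / real L \<le> \<delta> / 4" "5 / real r \<le> \<delta> / 4"
    using r0 r0' \<delta> by (auto simp: L_def r_def field_simps)
  define n where "n = (8 * L + 2) * (2 * r)"
  have "real (8 * L + 2) * (2 * real r) \<le> n + 8 * L" by (simp add: n_def algebra_simps)
  then have "(8 * L + 2) / (n + 8 * L) \<le> 1 / (2 * real r)"
    using r0' by (simp add: r_def L_def field_simps)
  moreover have "L > 0" "n > 0" "even r" "r \<ge> 6" using r0' by (auto simp: L_def n_def r_def)
  ultimately obtain G :: "nat pair_pre_digraph" where G: "pair_graph G"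
    "(1 - 2 / L) * card (pverts G) < vc G" "OPT G \<le> card (pverts G) * ((1 + 5 / r) / 2)"
    using integrality_gap_graph by blast
  let ?c = "real (card (pverts G))"
  have "(2 - \<epsilon>) * OPT G \<le> (2 - \<delta>) * OPT G"
    using \<delta> OPT_nonneg by (intro mult_right_mono) auto
  also have "\<dots> \<le> (2 - \<delta>) * (?c * ((1 + \<delta> / 4) / 2))"
    using G(3) d(2) \<delta> by (intro mult_left_mono order_trans[OF G(3)]) auto
  \<comment> \<open>The loss of \<open>\<delta> / 4\<close> against 1 pays for the fraction
    \<open>2 / L\<close> that a cover may omit.\<close>
  also have "\<dots> = (1 - \<delta> / 4 - \<delta>\<^sup>2 / 8) * ?c"
    by (simp add: power2_eq_square field_simps)
  also have "\<dots> \<le> (1 - 2 / L) * ?c"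
    using d(1) zero_le_power2[of \<delta>] by (intro mult_right_mono) linarith+
  also have "\<dots> < vc G" by (rule G(2))
  finally show ?thesis using G(1) by blast
qed

end
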